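(* Fix $L_x,L_{xy},L_y,D_x,D_y,\epsilon>0$ and query costs $c_x,c_y\ge0$. Let $\mathcal M$ be a distributed gradient-span algorithm for the class $\mathcal P_{\mathrm{SP}}$ (see context). Suppose the dimensions of $\mathcal E_x=\mathbb R^{n_x}$ and $\mathcal E_y=\mathbb R^{n_y}$ satisfy $$n_x\ge\frac{2L_{xy}D_xD_y}{3\epsilon}+\sqrt{\frac{3L_xD_x^2}{8\epsilon}}+2,\qquad n_y\ge\frac{2L_{xy}D_xD_y}{3\epsilon}+\sqrt{\frac{3L_yD_y^2}{8\epsilon}}+2.$$ Then the communication complexity and oracle complexity of $\mathcal M$ over $\mathcal P_{\mathrm{SP}}$ satisfy $$T^{\mathcal M}_{\mathcal P_{\mathrm{SP}}}\ge\frac{2L_{xy}D_xD_y}{3\epsilon}-2,$$ $$N^{\mathcal M}_{\mathcal P_{\mathrm{SP}}}\ge\frac{c_x+c_y}{9}\,\frac{L_{xy}D_xD_y}{\epsilon}+\frac{c_x}3\sqrt{\frac{3L_xD_x^2}{32\epsilon}}+\frac{c_y}3\sqrt{\frac{3L_yD_y^2}{32\epsilon}}-\frac{2c_x+2c_y}{3}.$$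
   Context: Spaces. $\mathcal E_x=\mathbb R^{n_x}$ carries the norm $\|x\|_x=\langle P_xx,x\rangle^{1/2}$, $P_x:\mathcal E_x\to\mathcal E_x^*$ self-adjoint positive definite, with dual norm $\|\cdot\|_{x^*}$; similarly $\mathcal E_y=\mathbb R^{n_y}$ with $P_y$. (The paper's argument is written for the standard Euclidean norms, $P_x=I$, $P_y=I$, stating that the general case is proven similarly.) Problem class $\mathcal P_{\mathrm{SP}}$. An instance is $(f,\psi_x,\psi_y,z^0)$ with $\psi_x:\mathcal E_x\to\mathbb R\cup\{+\infty\}$, $\psi_y:\mathcal E_y\to\mathbb R\cup\{+\infty\}$, $Q=\operatorname{dom}\psi_x\times\operatorname{dom}\psi_y$, $f$ real-valued on an open set containing $Q$, $z^0=(x^0,y^0)\in Q$; the problem is $\min_x\max_yF(x,y)$, $F(x,y)=f(x,y)+\psi_x(x)-\psi_y(y)$. The class consists of all instances such that: (A1) $f(\cdot,y)$ is convex for each $y\in\operatorname{dom}\psi_y$, $f(x,\cdot)$ is concave for each $x\in\operatorname{dom}\psi_x$, and $\psi_x,\psi_y$ are proper, closed, convex; (A2) there is a saddle point $(x^*,y^* )\in Q$ of $F$ with $\|x^0-x^*\|_x\le D_x$, $\|y^0-y^*\|_y\le D_y$; (A3) $f$ is continuously differentiable over $Q$ and for all $x,x'\in\operatorname{dom}\psi_x$, $y,y'\in\operatorname{dom}\psi_y$: $\|\nabla_xf(x',y')-\nabla_xf(x,y)\|_{x^*}\le L_x\|x'-x\|_x+L_{xy}\|y'-y\|_y$ and $\|\nabla_yf(x',y')-\nabla_yf(x,y)\|_{y^*}\le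 L_{xy}\|x'-x\|_x+L_y\|y'-y\|_y$. $\mathcal P^\circ_{\mathrm{SP}}\subset\mathcal P_{\mathrm{SP}}$ is the subclass with $\psi_x\equiv0$, $\psi_y\equiv0$. Accuracy. $\mathcal B=\{(x,y):\|x^0-x\|_x\le D_x,\|y^0-y\|_y\le D_y\}$, $\Delta(\bar x,\bar y)=\max_{(x,y)\in\mathcal B\cap Q}[F(\bar x,y)-F(x,\bar y)]$; $\bar z\in Q$ is an $\epsilon$-saddle point if $\Delta(\bar z)\le\epsilon$. Distributed method. It proceeds in communication rounds $t=0,1,\dots,T-1$ ($T$ may be adaptive). In round $t$ Agent $x$ queries $\nabla_xf$ at points $z_x^{t,l}=(x^{t,l},\hat y^{t,l})$, $0\le l<\tau_x^t$, and Agent $y$ queries $\nabla_yf$ at points $z_y^{t,l}=(\hat x^{t,l},y^{t,l})$, $0\le l<\tau_y^t$ (the numbers of local queries are chosen by the agents based on accumulated information). Each query point is a deterministic function of the querying agent's information (initial point, its own $\psi$, and the ordered sequence of oracle responses available to it); this sequence is initially empty, grows by each response, and at the end of each round both agents' sequences are replaced by the merged sequence. At the end of round $t$ a candidate solution $\bar z^{t+1}=(\bar x^{t+1},\bar y^{t+1})$, a deterministic function of the merged sequence, is produced. Gradient-span. Let $Z_x^{t-1}$ (resp. $Z_y^{t-1}$) be the set of all points queried by Agent $x$ (resp. $y$) in rounds $0,\dots,t-1$ (with $Z_x^{-1}=Z_y^{-1}=\emptyset$), and $Z_x^{t,l}=Z_x^{t-1}\cup\{z_x^{t,i}:0\le i<l\}$,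 $Z_y^{t,l}=Z_y^{t-1}\cup\{z_y^{t,i}:0\le i<l\}$. The method is gradient-span if for every instance of $\mathcal P^\circ_{\mathrm{SP}}$, all $t$ and all respective local steps $l$: (local variables) $x^{t,l}\in x^0+P_x^{-1}\operatorname{span}\{\nabla_xf(z):z\in Z_x^{t,l}\}$ and $y^{t,l}\in y^0+P_y^{-1}\operatorname{span}\{\nabla_yf(z):z\in Z_y^{t,l}\}$; (remote variables) $\hat y^{t,l}\in y^0+P_y^{-1}\operatorname{span}\{\nabla_yf(z):z\in Z_y^{t-1}\}$ and $\hat x^{t,l}\in x^0+P_x^{-1}\operatorname{span}\{\nabla_xf(z):z\in Z_x^{t-1}\}$; (candidate solutions) $\bar x^{t+1}\in x^0+P_x^{-1}\operatorname{span}\{\nabla_xf(z):z\in Z_x^t\}$ and $\bar y^{t+1}\in y^0+P_y^{-1}\operatorname{span}\{\nabla_yf(z):z\in Z_y^t\}$. Complexities. For an instance $P$, $T_P^{\mathcal M}$ is the smallest $k\ge1$ such that $\bar z^k$ is an $\epsilon$-saddle point ($+\infty$ if there is none), $N_{x,P}^{\mathcal M}=\sum_{t=0}^{T_P^{\mathcal M}-1}\tau_x^t$, $N_{y,P}^{\mathcal M}=\sum_{t=0}^{T_P^{\mathcal M}-1}\tau_y^t$; $T^{\mathcal M}_{\mathcal P_{\mathrm{SP}}}=\sup_PT_P^{\mathcal M}$ and $N^{\mathcal M}_{\mathcal P_{\mathrm{SP}}}=\sup_P(c_xN_{x,P}^{\mathcal M}+c_yN_{y,P}^{\mathcal M})$.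 If the accuracy is never reached on some instance, both complexities are $+\infty$. *)

theory Defs
  imports "HOL-Analysis.Analysis"
begin

section \<open>Norms\<close>

text \<open>
  The dual space is identified with the space itself through the standard inner product,
  so \<open>P : E \<rightarrow> E\<^sup>*\<close> becomes an endomorphism and \<open>\<nabla>f\<close> an ordinary vector.
\<close>

definition self_adjoint_pos_def :: "('a::real_inner \<Rightarrow> 'a) \<Rightarrow> bool" where
  "self_adjoint_pos_def P \<longleftrightarrow>
     linear P \<and> (\<forall>x y. P x \<bullet> y = x \<bullet> P y) \<and> (\<forall>x. x \<noteq> 0 \<longrightarrow> P x \<bullet> x > 0)"

definition pnorm :: "('a::real_inner \<Rightarrow> 'a) \<Rightarrow> 'a \<Rightarrow> real" where
  "pnorm P x = sqrt (P x \<bullet> x)"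

definition dual_pnorm :: "('a::real_inner \<Rightarrow> 'a) \<Rightarrow> 'a \<Rightarrow> real" where
  "dual_pnorm P s = (SUP x\<in>{x. pnorm P x \<le> 1}. s \<bullet> x)"


section \<open>Extended-valued convex functions and partial gradients\<close>

definition edom :: "('a \<Rightarrow> ereal) \<Rightarrow> 'a set" where
  "edom \<psi> = {x. \<psi> x < \<infinity>}"

definition epigraph :: "('a \<Rightarrow> ereal) \<Rightarrow> ('a \<times> real) set" where
  "epigraph \<psi> = {(x, t). \<psi> x \<le> ereal t}"

definition proper_closed_convex :: "('a::euclidean_space \<Rightarrow> ereal) \<Rightarrow> bool" where
  "proper_closed_convex \<psi> \<longleftrightarrow>
     (\<forall>x. \<psi> x \<noteq> -\<infinity>) \<and> edom \<psi> \<noteq> {} \<and> closed (epigraph \<psi>) \<and> convex (epigraph \<psi>)"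

definition grad_x :: "('a::real_inner \<times> 'b \<Rightarrow> real) \<Rightarrow> 'a \<times> 'b \<Rightarrow> 'a" where
  "grad_x f z = (THE g. GDERIV (\<lambda>x. f (x, snd z)) (fst z) :> g)"

definition grad_y :: "('a \<times> 'b::real_inner \<Rightarrow> real) \<Rightarrow> 'a \<times> 'b \<Rightarrow> 'b" where
  "grad_y f z = (THE g. GDERIV (\<lambda>y. f (fst z, y)) (snd z) :> g)"


section \<open>Saddle-point problems\<close>

text \<open>
  \<open>sp_U\<close> is the open set on which \<open>sp_f\<close> is defined; the values of \<open>sp_f\<close> outside it
  are never used.
\<close>

record ('a, 'b) sp_instance =
  sp_f :: "'a \<times> 'b \<Rightarrow> real"
  sp_U :: "('a \<times> 'b) set"
  psi_x :: "'a \<Rightarrow> ereal"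
  psi_y :: "'b \<Rightarrow> ereal"
  z0 :: "'a \<times> 'b"

definition sp_Q :: "('a, 'b) sp_instance \<Rightarrow> ('a \<times> 'b) set" where
  "sp_Q I = edom (psi_x I) \<times> edom (psi_y I)"

text \<open>Finite on \<open>sp_Q I\<close>, and only used there.\<close>

definition sp_F :: "('a, 'b) sp_instance \<Rightarrow> 'a \<times> 'b \<Rightarrow> ereal" where
  "sp_F I z = ereal (sp_f I z) + psi_x I (fst z) - psi_y I (snd z)"

definition saddle_point :: "('a, 'b) sp_instance \<Rightarrow> 'a \<times> 'b \<Rightarrow> bool" where
  "saddle_point I zs \<longleftrightarrow> zs \<in> sp_Q I \<and>
     (\<forall>(x, y)\<in>sp_Q I. sp_F I (fst zs, y) \<le> sp_F I zs \<and> sp_F I zs \<le> sp_F I (x, snd zs))"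

definition sp_ball :: "('a::real_inner \<Rightarrow> 'a) \<Rightarrow> ('b::real_inner \<Rightarrow> 'b) \<Rightarrow> real \<Rightarrow> real \<Rightarrow>
    ('a, 'b) sp_instance \<Rightarrow> ('a \<times> 'b) set" where
  "sp_ball Px Py Dx Dy I =
     {(x, y). pnorm Px (fst (z0 I) - x) \<le> Dx \<and> pnorm Py (snd (z0 I) - y) \<le> Dy}"

text \<open>
  \<open>f\<close> need not be defined off \<open>sp_U I\<close>, so convexity of \<open>f(\<cdot>, y)\<close> is understood on
  \<open>dom \<psi>\<^sub>x\<close>, and concavity of \<open>f(x, \<cdot>)\<close> on \<open>dom \<psi>\<^sub>y\<close>.
\<close>

definition SP_class :: "('a::euclidean_space \<Rightarrow> 'a) \<Rightarrow> ('b::euclidean_space \<Rightarrow> 'b) \<Rightarrow>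
    real \<Rightarrow> real \<Rightarrow> real \<Rightarrow> real \<Rightarrow> real \<Rightarrow> ('a, 'b) sp_instance set" where
  "SP_class Px Py Lx Lxy Ly Dx Dy = {I.
     open (sp_U I) \<and> sp_Q I \<subseteq> sp_U I \<and> z0 I \<in> sp_Q I \<and>
     (\<forall>y\<in>edom (psi_y I). convex_on (edom (psi_x I)) (\<lambda>x. sp_f I (x, y))) \<and>
     (\<forall>x\<in>edom (psi_x I). concave_on (edom (psi_y I)) (\<lambda>y. sp_f I (x, y))) \<and>
     proper_closed_convex (psi_x I) \<and> proper_closed_convex (psi_y I) \<and>
     (\<exists>zs. saddle_point I zs \<and> zs \<in> sp_ball Px Py Dx Dy I) \<and>
     (\<exists>g. (\<forall>z\<in>sp_Q I. GDERIV (sp_f I) z :> g z) \<and> continuous_on (sp_Q I) g) \<and>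
     (\<forall>(x, y)\<in>sp_Q I. \<forall>(x', y')\<in>sp_Q I.
        dual_pnorm Px (grad_x (sp_f I) (x', y') - grad_x (sp_f I) (x, y))
          \<le> Lx * pnorm Px (x' - x) + Lxy * pnorm Py (y' - y) \<and>
        dual_pnorm Py (grad_y (sp_f I) (x', y') - grad_y (sp_f I) (x, y))
          \<le> Lxy * pnorm Px (x' - x) + Ly * pnorm Py (y' - y))}"

definition SP0_class :: "('a::euclidean_space \<Rightarrow> 'a) \<Rightarrow> ('b::euclidean_space \<Rightarrow> 'b) \<Rightarrow>
    real \<Rightarrow> real \<Rightarrow> real \<Rightarrow> real \<Rightarrow> real \<Rightarrow> ('a, 'b) sp_instance set" where
  "SP0_class Px Py Lx Lxy Ly Dx Dy =
     {I \<in> SP_class Px Py Lx Lxy Ly Dx Dy. psi_x I = (\<lambda>_. 0) \<and> psi_y I = (\<lambda>_. 0)}"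

definition gap :: "('a::real_inner \<Rightarrow> 'a) \<Rightarrow> ('b::real_inner \<Rightarrow> 'b) \<Rightarrow> real \<Rightarrow> real \<Rightarrow>
    ('a, 'b) sp_instance \<Rightarrow> 'a \<times> 'b \<Rightarrow> ereal" where
  "gap Px Py Dx Dy I zb =
     (SUP (x, y)\<in>sp_ball Px Py Dx Dy I \<inter> sp_Q I. sp_F I (fst zb, y) - sp_F I (x, snd zb))"

definition eps_saddle :: "('a::real_inner \<Rightarrow> 'a) \<Rightarrow> ('b::real_inner \<Rightarrow> 'b) \<Rightarrow> real \<Rightarrow> real \<Rightarrow>
    real \<Rightarrow> ('a, 'b) sp_instance \<Rightarrow> 'a \<times> 'b \<Rightarrow> bool" where
  "eps_saddle Px Py Dx Dy \<epsilon> I zb \<longleftrightarrow> zb \<in> sp_Q I \<and> gap Px Py Dx Dy I zb \<le> ereal \<epsilon>"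


section \<open>Distributed methods\<close>

text \<open>
  Oracle responses. The answer is \<open>None\<close> at points where the partial gradient does not
  exist, which can only happen outside \<open>sp_Q\<close> (in particular never for instances with
  \<open>\<psi>\<^sub>x \<equiv> 0\<close> and \<open>\<psi>\<^sub>y \<equiv> 0\<close>); a query outside \<open>sp_Q\<close> is thus not forbidden.
\<close>

datatype ('a, 'b) response = Resp_x "'a option" | Resp_y "'b option"

definition oracle_x :: "('a::real_inner, 'b) sp_instance \<Rightarrow> 'a \<times> 'b \<Rightarrow> 'a option" where
  "oracle_x I z =
     (if z \<in> sp_U I \<and> (\<exists>g. GDERIV (\<lambda>x. sp_f I (x, snd z)) (fst z) :> g)
      then Some (grad_x (sp_f I) z) else None)"

definition oracle_y :: "('a, 'b::real_inner) sp_instance \<Rightarrow> 'a \<times> 'b \<Rightarrow> 'b option" where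
  "oracle_y I z =
     (if z \<in> sp_U I \<and> (\<exists>g. GDERIV (\<lambda>y. sp_f I (fst z, y)) (snd z) :> g)
      then Some (grad_y (sp_f I) z) else None)"

text \<open>
  The arguments of \<open>query_x\<close>, \<open>more_x\<close> are: the round \<open>t\<close>, the local step \<open>l\<close>, the initial
  point, the agent's own \<open>\<psi>\<close>, and the agent's current sequence of responses. Agent \<open>x\<close>
  performs its local query number \<open>l\<close> of round \<open>t\<close> iff \<open>more_x\<close> holds at all local steps
  \<open>\<le> l\<close> of the round, so the number of local queries may depend on responses received
  within the round. Similarly \<open>halt t \<dots>\<close> says that the method stops after \<open>t\<close> completed
  rounds, i.e. instead of performing round \<open>t\<close>. \<open>candidate t\<close> is evaluated on the merged
  sequence at the end of round \<open>t\<close>.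
\<close>

record ('a, 'b) dist_alg =
  query_x :: "nat \<Rightarrow> nat \<Rightarrow> 'a \<times> 'b \<Rightarrow> ('a \<Rightarrow> ereal) \<Rightarrow> ('a, 'b) response list \<Rightarrow> 'a \<times> 'b"
  more_x :: "nat \<Rightarrow> nat \<Rightarrow> 'a \<times> 'b \<Rightarrow> ('a \<Rightarrow> ereal) \<Rightarrow> ('a, 'b) response list \<Rightarrow> bool"
  query_y :: "nat \<Rightarrow> nat \<Rightarrow> 'a \<times> 'b \<Rightarrow> ('b \<Rightarrow> ereal) \<Rightarrow> ('a, 'b) response list \<Rightarrow> 'a \<times> 'b"
  more_y :: "nat \<Rightarrow> nat \<Rightarrow> 'a \<times> 'b \<Rightarrow> ('b \<Rightarrow> ereal) \<Rightarrow> ('a, 'b) response list \<Rightarrow> bool"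
  candidate :: "nat \<Rightarrow> 'a \<times> 'b \<Rightarrow> ('a \<Rightarrow> ereal) \<Rightarrow> ('b \<Rightarrow> ereal) \<Rightarrow>
    ('a, 'b) response list \<Rightarrow> 'a \<times> 'b"
  halt :: "nat \<Rightarrow> 'a \<times> 'b \<Rightarrow> ('a \<Rightarrow> ereal) \<Rightarrow> ('b \<Rightarrow> ereal) \<Rightarrow>
    ('a, 'b) response list \<Rightarrow> bool"

text \<open>
  \<open>local_x M I t s l\<close>: the first \<open>l\<close> responses Agent \<open>x\<close> gets in round \<open>t\<close> if the merged
  sequence at the start of the round is \<open>s\<close> (irrespective of \<open>more_x\<close>).
\<close>

primrec local_x :: "('a::real_inner, 'b) dist_alg \<Rightarrow> ('a, 'b) sp_instance \<Rightarrow> nat \<Rightarrow>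
    ('a, 'b) response list \<Rightarrow> nat \<Rightarrow> ('a, 'b) response list" where
  "local_x M I t s 0 = []"
| "local_x M I t s (Suc l) = local_x M I t s l @
     [Resp_x (oracle_x I (query_x M t l (z0 I) (psi_x I) (s @ local_x M I t s l)))]"

primrec local_y :: "('a, 'b::real_inner) dist_alg \<Rightarrow> ('a, 'b) sp_instance \<Rightarrow> nat \<Rightarrow>
    ('a, 'b) response list \<Rightarrow> nat \<Rightarrow> ('a, 'b) response list" where
  "local_y M I t s 0 = []"
| "local_y M I t s (Suc l) = local_y M I t s l @
     [Resp_y (oracle_y I (query_y M t l (z0 I) (psi_y I) (s @ local_y M I t s l)))]"

definition local_num_x :: "('a::real_inner, 'b) dist_alg \<Rightarrow> ('a, 'b) sp_instance \<Rightarrow> nat \<Rightarrow>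
    ('a, 'b) response list \<Rightarrow> nat" where
  "local_num_x M I t s = (LEAST l. \<not> more_x M t l (z0 I) (psi_x I) (s @ local_x M I t s l))"

definition local_num_y :: "('a, 'b::real_inner) dist_alg \<Rightarrow> ('a, 'b) sp_instance \<Rightarrow> nat \<Rightarrow>
    ('a, 'b) response list \<Rightarrow> nat" where
  "local_num_y M I t s = (LEAST l. \<not> more_y M t l (z0 I) (psi_y I) (s @ local_y M I t s l))"

text \<open>\<open>merged M I t\<close>: the common sequence of both agents at the start of round \<open>t\<close>.\<close>

primrec merged :: "('a::real_inner, 'b::real_inner) dist_alg \<Rightarrow> ('a, 'b) sp_instance \<Rightarrow>
    nat \<Rightarrow> ('a, 'b) response list" where
  "merged M I 0 = []"
| "merged M I (Suc t) = merged M I t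
     @ local_x M I t (merged M I t) (local_num_x M I t (merged M I t))
     @ local_y M I t (merged M I t) (local_num_y M I t (merged M I t))"

definition tau_x :: "('a::real_inner, 'b::real_inner) dist_alg \<Rightarrow> ('a, 'b) sp_instance \<Rightarrow>
    nat \<Rightarrow> nat" where
  "tau_x M I t = local_num_x M I t (merged M I t)"

definition tau_y :: "('a::real_inner, 'b::real_inner) dist_alg \<Rightarrow> ('a, 'b) sp_instance \<Rightarrow>
    nat \<Rightarrow> nat" where
  "tau_y M I t = local_num_y M I t (merged M I t)"

definition point_x :: "('a::real_inner, 'b::real_inner) dist_alg \<Rightarrow> ('a, 'b) sp_instance \<Rightarrow>
    nat \<Rightarrow> nat \<Rightarrow> 'a \<times> 'b" where
  "point_x M I t l =
     query_x M t l (z0 I) (psi_x I) (merged M I t @ local_x M I t (merged M I t) l)"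

definition point_y :: "('a::real_inner, 'b::real_inner) dist_alg \<Rightarrow> ('a, 'b) sp_instance \<Rightarrow>
    nat \<Rightarrow> nat \<Rightarrow> 'a \<times> 'b" where
  "point_y M I t l =
     query_y M t l (z0 I) (psi_y I) (merged M I t @ local_y M I t (merged M I t) l)"

text \<open>
  \<open>cand M I (t + 1)\<close> is the candidate produced at the end of round \<open>t\<close>; \<open>cand M I 0\<close> is
  meaningless and never used.
\<close>

definition cand :: "('a::real_inner, 'b::real_inner) dist_alg \<Rightarrow> ('a, 'b) sp_instance \<Rightarrow>
    nat \<Rightarrow> 'a \<times> 'b" where
  "cand M I k = candidate M (k - 1) (z0 I) (psi_x I) (psi_y I) (merged M I k)"

text \<open>Round \<open>t\<close> takes place, i.e. \<open>t < T\<close> for the (possibly infinite) number \<open>T\<close> of rounds.\<close>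

definition round_active :: "('a::real_inner, 'b::real_inner) dist_alg \<Rightarrow>
    ('a, 'b) sp_instance \<Rightarrow> nat \<Rightarrow> bool" where
  "round_active M I t \<longleftrightarrow>
     (\<forall>s\<le>t. \<not> halt M s (z0 I) (psi_x I) (psi_y I) (merged M I s))"

text \<open>
  Every round that takes place has finitely many local queries. This makes the \<open>LEAST\<close> in
  \<open>local_num_x\<close>, \<open>local_num_y\<close> meaningful.
\<close>

definition distributed_for :: "('a::real_inner, 'b::real_inner) sp_instance set \<Rightarrow>
    ('a, 'b) dist_alg \<Rightarrow> bool" where
  "distributed_for C M \<longleftrightarrow> (\<forall>I\<in>C. \<forall>t. round_active M I t \<longrightarrow>
     (\<exists>l. \<not> more_x M t l (z0 I) (psi_x I) (merged M I t @ local_x M I t (merged M I t) l)) \<and>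
     (\<exists>l. \<not> more_y M t l (z0 I) (psi_y I) (merged M I t @ local_y M I t (merged M I t) l)))"


section \<open>Gradient-span methods\<close>

text \<open>
  Points queried in rounds \<open>0, \<dots>, t - 1\<close>; hence \<open>Z_x M I t\<close> is \<open>Z\<^sub>x\<^bsup>t-1\<^esup>\<close> in the usual notation.
\<close>

definition Z_x :: "('a::real_inner, 'b::real_inner) dist_alg \<Rightarrow> ('a, 'b) sp_instance \<Rightarrow>
    nat \<Rightarrow> ('a \<times> 'b) set" where
  "Z_x M I t = {point_x M I s l | s l. s < t \<and> l < tau_x M I s}"

definition Z_y :: "('a::real_inner, 'b::real_inner) dist_alg \<Rightarrow> ('a, 'b) sp_instance \<Rightarrow>
    nat \<Rightarrow> ('a \<times> 'b) set" where
  "Z_y M I t = {point_y M I s l | s l. s < t \<and> l < tau_y M I s}"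

definition span_x :: "('a::euclidean_space \<Rightarrow> 'a) \<Rightarrow> ('a, 'b) sp_instance \<Rightarrow>
    ('a \<times> 'b) set \<Rightarrow> 'a set" where
  "span_x Px I Z = (\<lambda>v. fst (z0 I) + inv Px v) ` span (grad_x (sp_f I) ` Z)"

definition span_y :: "('b::euclidean_space \<Rightarrow> 'b) \<Rightarrow> ('a, 'b) sp_instance \<Rightarrow>
    ('a \<times> 'b) set \<Rightarrow> 'b set" where
  "span_y Py I Z = (\<lambda>v. snd (z0 I) + inv Py v) ` span (grad_y (sp_f I) ` Z)"

definition gradient_span :: "('a::euclidean_space \<Rightarrow> 'a) \<Rightarrow> ('b::euclidean_space \<Rightarrow> 'b) \<Rightarrow>
    ('a, 'b) sp_instance set \<Rightarrow> ('a, 'b) dist_alg \<Rightarrow> bool" where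
  "gradient_span Px Py C M \<longleftrightarrow> (\<forall>I\<in>C. \<forall>t. round_active M I t \<longrightarrow>
     (\<forall>l<tau_x M I t.
        fst (point_x M I t l) \<in> span_x Px I (Z_x M I t \<union> point_x M I t ` {..<l}) \<and>
        snd (point_x M I t l) \<in> span_y Py I (Z_y M I t)) \<and>
     (\<forall>l<tau_y M I t.
        snd (point_y M I t l) \<in> span_y Py I (Z_y M I t \<union> point_y M I t ` {..<l}) \<and>
        fst (point_y M I t l) \<in> span_x Px I (Z_x M I t)) \<and>
     fst (cand M I (t + 1)) \<in> span_x Px I (Z_x M I (t + 1)) \<and>
     snd (cand M I (t + 1)) \<in> span_y Py I (Z_y M I (t + 1)))"


section \<open>Complexities\<close>

definition solved_at :: "('a::real_inner \<Rightarrow> 'a) \<Rightarrow> ('b::real_inner \<Rightarrow> 'b) \<Rightarrow> real \<Rightarrow> real \<Rightarrow>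
    real \<Rightarrow> ('a, 'b) dist_alg \<Rightarrow> ('a, 'b) sp_instance \<Rightarrow> nat \<Rightarrow> bool" where
  "solved_at Px Py Dx Dy \<epsilon> M I k \<longleftrightarrow>
     k \<ge> 1 \<and> round_active M I (k - 1) \<and> eps_saddle Px Py Dx Dy \<epsilon> I (cand M I k)"

definition T_inst :: "('a::real_inner \<Rightarrow> 'a) \<Rightarrow> ('b::real_inner \<Rightarrow> 'b) \<Rightarrow> real \<Rightarrow> real \<Rightarrow>
    real \<Rightarrow> ('a, 'b) dist_alg \<Rightarrow> ('a, 'b) sp_instance \<Rightarrow> enat" where
  "T_inst Px Py Dx Dy \<epsilon> M I =
     (if \<exists>k. solved_at Px Py Dx Dy \<epsilon> M I k
      then enat (LEAST k. solved_at Px Py Dx Dy \<epsilon> M I k) else \<infinity>)"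

definition comm_complexity :: "('a::real_inner \<Rightarrow> 'a) \<Rightarrow> ('b::real_inner \<Rightarrow> 'b) \<Rightarrow> real \<Rightarrow> real \<Rightarrow>
    real \<Rightarrow> ('a, 'b) sp_instance set \<Rightarrow> ('a, 'b) dist_alg \<Rightarrow> ereal" where
  "comm_complexity Px Py Dx Dy \<epsilon> C M =
     (SUP I\<in>C. ereal_of_enat (T_inst Px Py Dx Dy \<epsilon> M I))"

text \<open>
  The query counts of an instance that is never solved are set to \<open>\<infinity>\<close>. As \<open>0 * \<infinity> = 0\<close> in
  \<^typ>\<open>ereal\<close>, that convention is stated again in \<open>oracle_complexity\<close>, to cover zero costs.
\<close>

definition N_x_inst :: "('a::real_inner \<Rightarrow> 'a) \<Rightarrow> ('b::real_inner \<Rightarrow> 'b) \<Rightarrow> real \<Rightarrow> real \<Rightarrow>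
    real \<Rightarrow> ('a, 'b) dist_alg \<Rightarrow> ('a, 'b) sp_instance \<Rightarrow> ereal" where
  "N_x_inst Px Py Dx Dy \<epsilon> M I =
     (case T_inst Px Py Dx Dy \<epsilon> M I of
        enat T \<Rightarrow> ereal (real (\<Sum>t<T. tau_x M I t)) | \<infinity> \<Rightarrow> \<infinity>)"

definition N_y_inst :: "('a::real_inner \<Rightarrow> 'a) \<Rightarrow> ('b::real_inner \<Rightarrow> 'b) \<Rightarrow> real \<Rightarrow> real \<Rightarrow>
    real \<Rightarrow> ('a, 'b) dist_alg \<Rightarrow> ('a, 'b) sp_instance \<Rightarrow> ereal" where
  "N_y_inst Px Py Dx Dy \<epsilon> M I =
     (case T_inst Px Py Dx Dy \<epsilon> M I of
        enat T \<Rightarrow> ereal (real (\<Sum>t<T. tau_y M I t)) | \<infinity> \<Rightarrow> \<infinity>)"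

definition oracle_complexity :: "('a::real_inner \<Rightarrow> 'a) \<Rightarrow> ('b::real_inner \<Rightarrow> 'b) \<Rightarrow> real \<Rightarrow>
    real \<Rightarrow> real \<Rightarrow> real \<Rightarrow> real \<Rightarrow> ('a, 'b) sp_instance set \<Rightarrow> ('a, 'b) dist_alg \<Rightarrow> ereal" where
  "oracle_complexity Px Py Dx Dy \<epsilon> cx cy C M =
     (if \<exists>I\<in>C. T_inst Px Py Dx Dy \<epsilon> M I = \<infinity> then \<infinity>
      else (SUP I\<in>C. ereal cx * N_x_inst Px Py Dx Dy \<epsilon> M I
                     + ereal cy * N_y_inst Px Py Dx Dy \<epsilon> M I))"

end

theory Submission
  imports Defs
begin

text \<open>
  Both hard instances have \<open>\<psi>\<^sub>x = \<psi>\<^sub>y = 0\<close> and start at the origin. In coordinates with respect to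
  \<open>P\<close>-orthonormal systems put \<open>r\<^sub>1 = x\<^sub>1 - c\<close> and \<open>r\<^sub>i = x\<^sub>i - x\<^sub>i\<^sub>-\<^sub>1\<close> for \<open>i > 1\<close>.

  In the first one \<open>f\<close> is a multiple of \<open>\<Sum> y\<^sub>i r\<^sub>i\<close>. A coordinate of \<open>x\<close> is revealed only
  to an agent who knows the same coordinate of \<open>y\<close>, and that one only from the previous
  coordinate of \<open>x\<close>; hence reaching \<open>x\<^sub>N\<close> takes \<open>2 N\<close> rounds and \<open>N\<close> queries of each agent. While
  \<open>x\<^sub>N = 0\<close> the residuals add up to \<open>- c\<close>, and testing with a constant vector \<open>y\<close> shows that
  the gap is at least \<open>L\<^sub>x\<^sub>y D\<^sub>x D\<^sub>y / (2 N)\<close>.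

  In the second one \<open>f(x, y)\<close> is the difference of Nesterov's quadratic worst-case functions of
  \<open>x\<close> and of \<open>y\<close>, which bounds the queries of the two agents independently. The oracle bound
  holds because it is a third of the sum of the two bounds obtained.
\<close>

section \<open>Orthonormal systems and the difference forms\<close>

lemma self_adjoint_pos_def_linear: "self_adjoint_pos_def P \<Longrightarrow> linear P"
  and self_adjoint_pos_def_sym: "self_adjoint_pos_def P \<Longrightarrow> P x \<bullet> y = x \<bullet> P y"
  by (auto simp: self_adjoint_pos_def_def)

lemma self_adjoint_pos_def_nonneg: "self_adjoint_pos_def P \<Longrightarrow> P x \<bullet> x \<ge> 0"
  unfolding self_adjoint_pos_def_def by (cases "x = 0") (auto simp: less_imp_le)

lemma self_adjoint_pos_def_inv:
  fixes P :: "'a::euclidean_space \<Rightarrow> 'a"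
  assumes "self_adjoint_pos_def P"
  shows "P (inv P v) = v"
proof -
  have lin: "linear P" using assms by (rule self_adjoint_pos_def_linear)
  have "inj P"
    unfolding linear_injective_0[OF lin] using assms
    by (auto simp: self_adjoint_pos_def_def)
  with lin have "surj P" by (simp add: linear_injective_imp_surjective)
  then show ?thesis by (simp add: surj_f_inv_f)
qed

lemma pnorm_nonneg: "self_adjoint_pos_def P \<Longrightarrow> pnorm P x \<ge> 0"
  by (simp add: pnorm_def self_adjoint_pos_def_nonneg)

lemma pnorm_power2: "self_adjoint_pos_def P \<Longrightarrow> (pnorm P x)\<^sup>2 = P x \<bullet> x"
  by (simp add: pnorm_def self_adjoint_pos_def_nonneg)

lemma pnorm_zero: "self_adjoint_pos_def P \<Longrightarrow> pnorm P 0 = 0"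
  by (simp add: pnorm_def)

lemma pnorm_minus: "self_adjoint_pos_def P \<Longrightarrow> pnorm P (- x) = pnorm P x"
  by (simp add: pnorm_def linear_neg[OF self_adjoint_pos_def_linear])

text \<open>Turns each Lipschitz estimate below into a Cauchy-Schwarz bound against an arbitrary
  direction \<open>h\<close>; on the unit ball \<open>0 \<le> C\<close> lets the factor
  \<open>pnorm P h\<close> be replaced by 1.\<close>

lemma dual_pnorm_le:
  assumes "self_adjoint_pos_def P" and "0 \<le> C" and "\<And>h. s \<bullet> h \<le> C * pnorm P h"
  shows "dual_pnorm P s \<le> C"
  unfolding dual_pnorm_def
proof (rule cSUP_least)
  show "{x. pnorm P x \<le> 1} \<noteq> {}" using pnorm_zero[OF assms(1)] by (auto intro!: exI[of _ 0])
next
  fix h assume "h \<in> {x. pnorm P x \<le> 1}"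
  then have "C * pnorm P h \<le> C" using assms(2) by (simp add: mult_left_le)
  then show "s \<bullet> h \<le> C" using assms(3)[of h] by linarith
qed

lemma sum_mult_le_of_sum_squares_le:
  fixes f g :: "'i \<Rightarrow> real"
  assumes "(\<Sum>i\<in>I. (f i)\<^sup>2) \<le> A\<^sup>2" and "(\<Sum>i\<in>I. (g i)\<^sup>2) \<le> B\<^sup>2" and "0 \<le> A" and "0 \<le> B"
  shows "(\<Sum>i\<in>I. f i * g i) \<le> A * B"
proof -
  have "(\<Sum>i\<in>I. f i * g i)\<^sup>2 \<le> A\<^sup>2 * B\<^sup>2"
    using Cauchy_Schwarz_ineq_sum[of f g I] assms(1,2)
    by (meson mult_mono order_trans sum_nonneg zero_le_power2)
  then show ?thesis using assms(3,4)
    by (metis mult_nonneg_nonneg power2_le_imp_le power_mult_distrib)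
qed

text \<open>Gram-Schmidt for the inner product of \<open>P\<close>: below full dimension some
  nonzero vector is Euclidean-orthogonal to all \<open>P (u i)\<close>, and it only has to be
  normalized. This reduces general norms to coordinates.\<close>

lemma exists_orthonormal_family:
  fixes P :: "'a::euclidean_space \<Rightarrow> 'a"
  assumes P: "self_adjoint_pos_def P" and "n \<le> DIM('a)"
  shows "\<exists>u :: nat \<Rightarrow> 'a. \<forall>i<n. \<forall>j<n. P (u i) \<bullet> u j = (if i = j then 1 else 0)"
  using assms(2)
proof (induction n)
  case 0
  then show ?case by simp
next
  case (Suc n)
  then obtain u :: "nat \<Rightarrow> 'a"
    where u: "\<And>i j. i < n \<Longrightarrow> j < n \<Longrightarrow> P (u i) \<bullet> u j = (if i = j then 1 else 0)"
    by auto
  let ?S = "(\<lambda>i. P (u i)) ` {..<n}"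
  have "dim (span ?S) \<le> card ?S" by (simp add: dim_le_card')
  also have "\<dots> \<le> n" using card_image_le[of "{..<n}"] by simp
  finally have "dim (span ?S) < DIM('a)" using Suc.prems by simp
  then obtain v where v: "v \<noteq> 0" "\<And>y. y \<in> span ?S \<Longrightarrow> orthogonal v y"
    using orthogonal_to_subspace_exists[of ?S] by (metis dim_span)
  define s where "s = sqrt (P v \<bullet> v)"
  define w where "w = (1 / s) *\<^sub>R v"
  have pos: "P v \<bullet> v > 0" using P v(1) unfolding self_adjoint_pos_def_def by blast
  then have s: "s > 0" "s * s = P v \<bullet> v" by (auto simp: s_def)
  have lin: "linear P" using P by (rule self_adjoint_pos_def_linear)
  have ww: "P w \<bullet> w = 1"
    using s pos by (simp add: w_def linear_scale[OF lin] field_simps)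
  have uw: "P (u i) \<bullet> w = 0" if "i < n" for i
  proof -
    have "orthogonal v (P (u i))" using that by (intro v(2) span_base) auto
    then show ?thesis by (simp add: w_def orthogonal_def inner_commute)
  qed
  have wu: "P w \<bullet> u i = 0" if "i < n" for i
    using uw[OF that] self_adjoint_pos_def_sym[OF P, of w "u i"] by (simp add: inner_commute)
  have "\<forall>i<Suc n. \<forall>j<Suc n. P ((u(n := w)) i) \<bullet> (u(n := w)) j = (if i = j then 1 else 0)"
    by (auto simp: less_Suc_eq u ww uw wu)
  then show ?case by blast
qed

section \<open>Coordinates along a \<open>P\<close>-orthonormal chain\<close>

locale chain =
  fixes P :: "'a::euclidean_space \<Rightarrow> 'a" and u :: "nat \<Rightarrow> 'a" and n :: nat
  assumes P: "self_adjoint_pos_def P"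
    and orthonormal: "\<And>i j. i < n \<Longrightarrow> j < n \<Longrightarrow> P (u i) \<bullet> u j = (if i = j then 1 else 0)"
begin

text \<open>The value 0 from index \<open>n\<close> on encodes the closing boundary condition: for
  \<open>n > 0\<close> the last form \<open>diff_form n\<close> is
  \<open>- coord (n - 1)\<close>.\<close>

definition coord :: "nat \<Rightarrow> 'a" where
  "coord i = (if i < n then P (u i) else 0)"

primrec diff_form :: "nat \<Rightarrow> 'a" where
  "diff_form 0 = coord 0"
| "diff_form (Suc i) = coord (Suc i) - coord i"

definition residual :: "real \<Rightarrow> nat \<Rightarrow> 'a \<Rightarrow> real" where
  "residual c i x = diff_form i \<bullet> x - (if i = 0 then c else 0)"

definition comb :: "(nat \<Rightarrow> real) \<Rightarrow> 'a" where
  "comb \<xi> = (\<Sum>i<n. \<xi> i *\<^sub>R u i)"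

text \<open>A condition on coordinates rather than a span of the \<open>u i\<close>, because the
  chain may be shorter than the dimension; components outside the chain stay free.\<close>

definition leading :: "nat \<Rightarrow> 'a set" where
  "leading k = {x. \<forall>i\<ge>k. coord i \<bullet> x = 0}"

text \<open>The image of \<^term>\<open>leading k\<close> under \<^term>\<open>P\<close>, where the gradients live.\<close>

definition leading_dual :: "nat \<Rightarrow> 'a set" where
  "leading_dual k = {v. \<forall>i\<ge>k. i < n \<longrightarrow> u i \<bullet> v = 0}"

lemma u_coord: "i < n \<Longrightarrow> u i \<bullet> coord j = (if i = j then 1 else 0)"
  by (auto simp: coord_def orthonormal inner_commute[of "u i"])

lemma coord_comb: "coord i \<bullet> comb \<xi> = (if i < n then \<xi> i else 0)"
  by (simp add: coord_def comb_def inner_sum_right orthonormal if_distrib[of "(*) _"] cong: if_cong)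

lemma P_comb: "P (comb \<xi>) = (\<Sum>i<n. \<xi> i *\<^sub>R coord i)"
  by (simp add: comb_def coord_def linear_sum[OF self_adjoint_pos_def_linear[OF P]]
      linear_scale[OF self_adjoint_pos_def_linear[OF P]])

lemma pnorm_comb: "(pnorm P (comb \<xi>))\<^sup>2 = (\<Sum>i<n. (\<xi> i)\<^sup>2)"
  unfolding pnorm_power2[OF P] by (simp add: P_comb inner_sum_left coord_comb power2_eq_square)

text \<open>\<open>comb\<close> of the coordinates of \<open>x\<close> is its
  \<open>P\<close>-orthogonal projection, and the remainder has nonnegative squared norm.\<close>

lemma bessel: "(\<Sum>i<n. (coord i \<bullet> x)\<^sup>2) \<le> (pnorm P x)\<^sup>2"
proof -
  let ?\<xi> = "\<lambda>i. coord i \<bullet> x"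
  have lin: "linear P" using P by (rule self_adjoint_pos_def_linear)
  have eq: "P (comb ?\<xi>) \<bullet> x = (\<Sum>i<n. (?\<xi> i)\<^sup>2)"
    by (simp add: P_comb inner_sum_left power2_eq_square)
  have "0 \<le> P (x - comb ?\<xi>) \<bullet> (x - comb ?\<xi>)"
    using P by (rule self_adjoint_pos_def_nonneg)
  also have "\<dots> = P x \<bullet> x - P x \<bullet> comb ?\<xi> - P (comb ?\<xi>) \<bullet> x + P (comb ?\<xi>) \<bullet> comb ?\<xi>"
    by (simp add: linear_diff[OF lin] inner_diff_left inner_diff_right)
  also have "P x \<bullet> comb ?\<xi> = P (comb ?\<xi>) \<bullet> x"
    by (metis inner_commute self_adjoint_pos_def_sym[OF P])
  also have "P (comb ?\<xi>) \<bullet> comb ?\<xi> = (\<Sum>i<n. (?\<xi> i)\<^sup>2)"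
    using pnorm_comb[of ?\<xi>] pnorm_power2[OF P, of "comb ?\<xi>"] by simp
  finally show ?thesis using eq pnorm_power2[OF P, of x] by simp
qed

lemma coord_bessel: "(\<Sum>i\<le>n. (coord i \<bullet> x)\<^sup>2) \<le> (pnorm P x)\<^sup>2"
  using bessel[of x] by (simp add: lessThan_Suc_atMost[symmetric] coord_def)

text \<open>Each coordinate enters at most two forms, so the difference operator has norm at most 2.
  This accounts for the factors \<open>L / 8\<close> and \<open>L / 2\<close> in the hard
  functions.\<close>

lemma diff_form_bessel: "(\<Sum>i\<le>n. (diff_form i \<bullet> x)\<^sup>2) \<le> (2 * pnorm P x)\<^sup>2"
proof -
  have *: "(a - b)\<^sup>2 \<le> 2 * a\<^sup>2 + 2 * b\<^sup>2" for a b :: real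
    using zero_le_power2[of "a + b"] by (simp add: power2_sum power2_diff)
  have "(\<Sum>i\<le>n. (diff_form i \<bullet> x)\<^sup>2)
      = (coord 0 \<bullet> x)\<^sup>2 + (\<Sum>i<n. (coord (Suc i) \<bullet> x - coord i \<bullet> x)\<^sup>2)"
    by (simp add: lessThan_Suc_atMost[symmetric] sum.lessThan_Suc_shift inner_diff_left
        del: sum.lessThan_Suc)
  also have "\<dots> \<le> (coord 0 \<bullet> x)\<^sup>2
      + (\<Sum>i<n. 2 * (coord (Suc i) \<bullet> x)\<^sup>2 + 2 * (coord i \<bullet> x)\<^sup>2)"
    by (intro add_left_mono sum_mono *)
  also have "\<dots> \<le> 2 * ((coord 0 \<bullet> x)\<^sup>2 + (\<Sum>i<n. (coord (Suc i) \<bullet> x)\<^sup>2))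
      + 2 * (\<Sum>i<n. (coord i \<bullet> x)\<^sup>2)"
    by (simp add: sum.distrib sum_distrib_left)
  also have "(coord 0 \<bullet> x)\<^sup>2 + (\<Sum>i<n. (coord (Suc i) \<bullet> x)\<^sup>2) = (\<Sum>i\<le>n. (coord i \<bullet> x)\<^sup>2)"
    by (simp add: lessThan_Suc_atMost[symmetric] sum.lessThan_Suc_shift del: sum.lessThan_Suc)
  finally show ?thesis
    using bessel[of x] coord_bessel[of x] by (simp add: power_mult_distrib)
qed

lemma sum_residual: "(\<Sum>i\<le>m. residual c i x) = coord m \<bullet> x - c"
  by (induction m) (auto simp: residual_def inner_diff_left)

text \<open>Cauchy--Schwarz, because the first \<open>m + 1\<close> residuals add up to \<open>- c\<close>.\<close>

lemma sum_residual_squares_ge: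
  assumes "coord m \<bullet> x = 0" and "m \<le> n"
  shows "c\<^sup>2 / real (Suc m) \<le> (\<Sum>i\<le>n. (residual c i x)\<^sup>2)"
proof -
  have "c\<^sup>2 = (\<Sum>i\<le>m. residual c i x)\<^sup>2" by (simp add: sum_residual assms(1))
  also have "\<dots> \<le> (\<Sum>i\<le>m. (residual c i x)\<^sup>2) * real (Suc m)"
    using sum_squared_le_sum_of_squares[of "\<lambda>i. residual c i x" "{..m}"] by simp
  finally have "c\<^sup>2 / real (Suc m) \<le> (\<Sum>i\<le>m. (residual c i x)\<^sup>2)"
    by (simp add: field_simps)
  also have "\<dots> \<le> (\<Sum>i\<le>n. (residual c i x)\<^sup>2)"
    using assms(2) by (intro sum_mono2) auto
  finally show ?thesis .
qed

lemma residual_diff: "residual c i x - residual c i y = diff_form i \<bullet> (x - y)"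
  by (simp add: residual_def inner_diff_right)

lemma residual_leading: "x \<in> leading k \<Longrightarrow> i > k \<Longrightarrow> residual c i x = 0"
  by (cases i) (auto simp: leading_def residual_def inner_diff_left)

text \<open>Only \<open>diff_form j\<close> and \<open>diff_form (Suc j)\<close> involve
  \<open>coord j\<close>, with opposite signs. Component \<open>j\<close> of a gradient therefore
  sees just two neighbouring weights.\<close>

lemma u_diff_form_sum:
  assumes "j < n"
  shows "u j \<bullet> (\<Sum>i\<le>n. r i *\<^sub>R diff_form i) = r j - r (Suc j)"
proof -
  have "u j \<bullet> (\<Sum>i\<le>n. r i *\<^sub>R diff_form i)
      = r 0 * (u j \<bullet> coord 0) + (\<Sum>i<n. r (Suc i) * (u j \<bullet> coord (Suc i) - u j \<bullet> coord i))"
    by (simp add: lessThan_Suc_atMost[symmetric] sum.lessThan_Suc_shift inner_sum_right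
        inner_diff_right inner_add_right del: sum.lessThan_Suc)
  also have "\<dots> = (r 0 * (u j \<bullet> coord 0) + (\<Sum>i<n. r (Suc i) * (u j \<bullet> coord (Suc i))))
       - (\<Sum>i<n. r (Suc i) * (u j \<bullet> coord i))"
    by (simp add: right_diff_distrib sum_subtractf)
  also have "(r 0 * (u j \<bullet> coord 0) + (\<Sum>i<n. r (Suc i) * (u j \<bullet> coord (Suc i))))
      = (\<Sum>i<Suc n. r i * (u j \<bullet> coord i))"
    by (simp add: sum.lessThan_Suc_shift del: sum.lessThan_Suc)
  finally show ?thesis
    using assms by (simp add: u_coord if_distrib[of "(*) _"] cong: if_cong)
qed

lemma leading_dual_mono: "k \<le> l \<Longrightarrow> leading_dual k \<subseteq> leading_dual l"
  by (auto simp: leading_dual_def)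

lemma subspace_leading_dual: "subspace (leading_dual k)"
  by (auto simp: leading_dual_def subspace_def inner_add_right)

lemma inv_leading_dual: "v \<in> leading_dual k \<Longrightarrow> inv P v \<in> leading k"
proof -
  have "P (u i) \<bullet> inv P v = u i \<bullet> v" for i
    using self_adjoint_pos_def_sym[OF P] self_adjoint_pos_def_inv[OF P] by metis
  then show "v \<in> leading_dual k \<Longrightarrow> inv P v \<in> leading k"
    by (auto simp: leading_dual_def leading_def coord_def)
qed

text \<open>The summand 0 is the starting point of the hard instances, matching the shape of
  \<open>span_x\<close> and \<open>span_y\<close>.\<close>

lemma span_leading:
  assumes "G \<subseteq> leading_dual k"
  shows "(\<lambda>v. 0 + inv P v) ` span G \<subseteq> leading k"
  using span_minimal[OF assms subspace_leading_dual] inv_leading_dual by auto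

end

section \<open>The worst-case convex quadratic\<close>

context chain
begin

text \<open>Nesterov's function up to an additive constant, which makes it a sum of squares.\<close>

definition worst :: "real \<Rightarrow> real \<Rightarrow> 'a \<Rightarrow> real" where
  "worst L c x = L / 8 * (\<Sum>i\<le>n. (residual c i x)\<^sup>2)"

definition worst_grad :: "real \<Rightarrow> real \<Rightarrow> 'a \<Rightarrow> 'a" where
  "worst_grad L c x = (L / 4) *\<^sub>R (\<Sum>i\<le>n. residual c i x *\<^sub>R diff_form i)"

text \<open>The coordinates fall linearly from \<open>c\<close> in front of the chain to 0 at index
  \<open>n\<close>, which makes all residuals equal: the equality case of Cauchy-Schwarz.\<close>

definition worst_min :: "real \<Rightarrow> 'a" where
  "worst_min c = comb (\<lambda>i. c * (1 - real (Suc i) / real (Suc n)))"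

lemma has_derivative_residual [derivative_intros]:
  assumes "(f has_derivative f') (at z within S)"
  shows "((\<lambda>z. residual c i (f z)) has_derivative (\<lambda>h. diff_form i \<bullet> f' h)) (at z within S)"
  unfolding residual_def by (auto intro!: derivative_eq_intros assms)

lemma continuous_on_residual [continuous_intros]:
  "continuous_on S f \<Longrightarrow> continuous_on S (\<lambda>z. residual c i (f z))"
  unfolding residual_def by (intro continuous_intros)

lemma GDERIV_worst: "GDERIV (worst L c) x :> worst_grad L c x"
  unfolding gderiv_def worst_def worst_grad_def
  by (auto intro!: derivative_eq_intros
      simp: inner_sum_right sum_distrib_left inner_commute[of _ "diff_form _"] fun_eq_iff algebra_simps)

lemma continuous_on_worst_grad [continuous_intros]:
  "continuous_on S f \<Longrightarrow> continuous_on S (\<lambda>z. worst_grad L c (f z))"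
  unfolding worst_grad_def by (intro continuous_intros)

text \<open>The second-order expansion is exact, and its remainder is a nonnegative multiple of a
  sum of squares.\<close>

lemma worst_above_tangent:
  assumes "0 \<le> L"
  shows "worst L c x + worst_grad L c x \<bullet> (y - x) \<le> worst L c y"
proof -
  have eq: "(residual c i y)\<^sup>2 = (residual c i x)\<^sup>2 + 2 * residual c i x * (diff_form i \<bullet> (y - x))
      + (diff_form i \<bullet> (y - x))\<^sup>2" for i
    unfolding residual_diff[of c, symmetric] by (simp add: power2_eq_square algebra_simps)
  have "worst L c y = worst L c x + worst_grad L c x \<bullet> (y - x)
      + L / 8 * (\<Sum>i\<le>n. (diff_form i \<bullet> (y - x))\<^sup>2)"
    unfolding worst_def worst_grad_def eq
    by (simp add: sum.distrib inner_sum_left distrib_left sum_distrib_left mult.assoc)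
  then show ?thesis using assms by (simp add: sum_nonneg)
qed

lemma worst_grad_lipschitz:
  assumes "0 \<le> L"
  shows "dual_pnorm P (worst_grad L c x' - worst_grad L c x) \<le> L * pnorm P (x' - x)"
proof (rule dual_pnorm_le[OF P])
  show "0 \<le> L * pnorm P (x' - x)" using assms pnorm_nonneg[OF P] by simp
  fix h
  have "(worst_grad L c x' - worst_grad L c x) \<bullet> h
      = L / 4 * (\<Sum>i\<le>n. (diff_form i \<bullet> (x' - x)) * (diff_form i \<bullet> h))"
    unfolding residual_diff[of c, symmetric] worst_grad_def
    by (simp add: inner_diff_left inner_sum_left sum_subtractf left_diff_distrib right_diff_distrib)
  \<comment> \<open>\<open>L / 4\<close> times a factor 2 from each of the two difference sums gives
    the constant \<open>L\<close>.\<close>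
  also have "\<dots> \<le> L / 4 * ((2 * pnorm P (x' - x)) * (2 * pnorm P h))"
    using assms pnorm_nonneg[OF P]
    by (intro mult_left_mono sum_mult_le_of_sum_squares_le diff_form_bessel) auto
  finally show "(worst_grad L c x' - worst_grad L c x) \<bullet> h \<le> L * pnorm P (x' - x) * pnorm P h"
    by simp
qed

text \<open>Component \<open>j\<close> of the gradient involves residuals \<open>j\<close> and
  \<open>j + 1\<close>, which vanish for \<open>j > k\<close>. A query thus reveals at most one new
  coordinate.\<close>

lemma worst_grad_leading: "x \<in> leading k \<Longrightarrow> worst_grad L c x \<in> leading_dual (Suc k)"
  by (auto simp: leading_dual_def worst_grad_def u_diff_form_sum residual_leading[of x k])

lemma worst_ge:
  assumes "coord m \<bullet> x = 0" and "m \<le> n" and "0 \<le> L"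
  shows "L / 8 * (c\<^sup>2 / real (Suc m)) \<le> worst L c x"
  unfolding worst_def using assms by (intro mult_left_mono sum_residual_squares_ge) auto

lemma residual_worst_min:
  assumes "i \<le> n"
  shows "residual c i (worst_min c) = - c / real (Suc n)"
proof -
  have *: "coord j \<bullet> worst_min c = c * (1 - real (Suc j) / real (Suc n))" if "j \<le> n" for j
    using that by (auto simp: worst_min_def coord_comb)
  show ?thesis using assms
    by (cases i) (simp_all add: residual_def inner_diff_left * of_nat_Suc[of "Suc j" for j] field_simps
        del: of_nat_Suc)
qed

lemma worst_worst_min: "worst L c (worst_min c) = L / 8 * (c\<^sup>2 / real (Suc n))"
  unfolding worst_def
  by (simp add: residual_worst_min power_divide power2_eq_square field_simps del: of_nat_Suc)

text \<open>The case \<open>m = n\<close> of \<open>worst_ge\<close> covers every \<open>x\<close>,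
  because \<open>coord n\<close> is 0, and its bound is the value attained at
  \<open>worst_min c\<close>.\<close>

lemma worst_min_le: "0 \<le> L \<Longrightarrow> worst L c (worst_min c) \<le> worst L c x"
  unfolding worst_worst_min by (rule worst_ge) (simp_all add: coord_def)

lemma pnorm_worst_min: "(pnorm P (worst_min c))\<^sup>2 \<le> c\<^sup>2 * real (Suc n) / 3"
proof -
  have sq: "6 * (\<Sum>i\<le>m. (real i)\<^sup>2) = real m * (real m + 1) * (2 * real m + 1)" for m
    by (induction m) (auto simp: algebra_simps power2_eq_square)
  have "(pnorm P (worst_min c))\<^sup>2 = (\<Sum>i<n. (c * (real (n - i) / real (Suc n)))\<^sup>2)"
    unfolding worst_min_def pnorm_comb
    by (intro sum.cong refl arg_cong[of _ _ "\<lambda>x. (c * x)\<^sup>2"]) (simp add: of_nat_diff field_simps)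
  also have "\<dots> = (c / real (Suc n))\<^sup>2 * (\<Sum>i<n. (real (n - i))\<^sup>2)"
    by (simp add: sum_distrib_left power_mult_distrib power_divide del: of_nat_Suc)
  also have "(\<Sum>i<n. (real (n - i))\<^sup>2) = (\<Sum>i\<le>n. (real i)\<^sup>2)"
    using sum.nat_diff_reindex[of "\<lambda>i. (real (Suc i))\<^sup>2" n]
    by (simp add: lessThan_Suc_atMost[symmetric] sum.lessThan_Suc_shift Suc_diff_Suc
        del: sum.lessThan_Suc of_nat_Suc)
  \<comment> \<open>The sum of squares n (n + 1) (2 n + 1) / 6 is at most (n + 1)^3 / 3. This is the
    origin of the 3 under the final square roots.\<close>
  also have "(c / real (Suc n))\<^sup>2 * \<dots> \<le> (c / real (Suc n))\<^sup>2 * (real (Suc n) ^ 3 / 3)"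
  proof (rule mult_left_mono)
    have "6 * (\<Sum>i\<le>n. (real i)\<^sup>2) \<le> 2 * real (Suc n) ^ 3"
      unfolding sq by (simp add: algebra_simps power3_eq_cube)
    then show "(\<Sum>i\<le>n. (real i)\<^sup>2) \<le> real (Suc n) ^ 3 / 3" by simp
  qed simp
  also have "\<dots> = c\<^sup>2 * real (Suc n) / 3"
    by (simp add: power_divide power3_eq_cube power2_eq_square del: of_nat_Suc)
  finally show ?thesis .
qed

end

section \<open>Smooth instances\<close>

text \<open>Averaging the tangent inequalities at the intermediate point cancels the linear
  terms.\<close>

lemma convex_on_UNIV_above_tangent:
  fixes f :: "'a::real_inner \<Rightarrow> real"
  assumes "\<And>x y. f x + g x \<bullet> (y - x) \<le> f y"
  shows "convex_on UNIV f"
proof (rule convex_onI)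
  fix t :: real and x y :: 'a
  assume t: "0 < t" "t < 1"
  let ?z = "(1 - t) *\<^sub>R x + t *\<^sub>R y"
  have "(1 - t) * (f ?z + g ?z \<bullet> (x - ?z)) + t * (f ?z + g ?z \<bullet> (y - ?z))
      \<le> (1 - t) * f x + t * f y"
    using t by (intro add_mono mult_left_mono assms) auto
  moreover have "(1 - t) * (f ?z + g ?z \<bullet> (x - ?z)) + t * (f ?z + g ?z \<bullet> (y - ?z)) = f ?z"
    by (simp add: inner_diff_right inner_add_right algebra_simps)
  ultimately show "f ?z \<le> (1 - t) * f x + t * f y" by simp
qed simp

lemma GDERIV_unique:
  assumes "GDERIV f x :> a" and "GDERIV f x :> b"
  shows "a = b"
proof -
  have "(\<lambda>h. h \<bullet> a) = (\<lambda>h. h \<bullet> b)"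
    using assms unfolding gderiv_def by (rule has_derivative_unique)
  then have "(a - b) \<bullet> a = (a - b) \<bullet> b" by metis
  then have "(a - b) \<bullet> (a - b) = 0" by (subst inner_diff_right) simp
  then show ?thesis by simp
qed

lemma grad_x_eq:
  assumes "GDERIV f z :> g"
  shows "grad_x f z = fst g"
proof -
  have "((\<lambda>x. f (x, snd z)) has_derivative (\<lambda>h. (h, 0) \<bullet> g)) (at (fst z))"
    by (rule has_derivative_compose[of "\<lambda>x. (x, snd z)" _ _ _ f])
      (use assms in \<open>auto intro!: derivative_eq_intros simp: gderiv_def\<close>)
  then have "GDERIV (\<lambda>x. f (x, snd z)) (fst z) :> fst g"
    by (simp add: gderiv_def inner_prod_def)
  then show ?thesis
    unfolding grad_x_def by (intro the_equality) (auto dest: GDERIV_unique)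
qed

lemma grad_y_eq:
  assumes "GDERIV f z :> g"
  shows "grad_y f z = snd g"
proof -
  have "((\<lambda>y. f (fst z, y)) has_derivative (\<lambda>h. (0, h) \<bullet> g)) (at (snd z))"
    by (rule has_derivative_compose[of "\<lambda>y. (fst z, y)" _ _ _ f])
      (use assms in \<open>auto intro!: derivative_eq_intros simp: gderiv_def\<close>)
  then have "GDERIV (\<lambda>y. f (fst z, y)) (snd z) :> snd g"
    by (simp add: gderiv_def inner_prod_def)
  then show ?thesis
    unfolding grad_y_def by (intro the_equality) (auto dest: GDERIV_unique)
qed

section \<open>Instances on the whole space started at the origin\<close>

definition smooth_instance :: "('a::zero \<times> 'b::zero \<Rightarrow> real) \<Rightarrow> ('a, 'b) sp_instance" where
  "smooth_instance f = \<lparr>sp_f = f, sp_U = UNIV, psi_x = (\<lambda>_. 0), psi_y = (\<lambda>_. 0), z0 = 0\<rparr>"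

lemma smooth_instance_simps [simp]:
  "sp_f (smooth_instance f) = f" "sp_U (smooth_instance f) = UNIV"
  "psi_x (smooth_instance f) = (\<lambda>_. 0)" "psi_y (smooth_instance f) = (\<lambda>_. 0)"
  "z0 (smooth_instance f) = 0"
  by (simp_all add: smooth_instance_def)

lemma edom_zero [simp]: "edom (\<lambda>_. 0) = UNIV"
  by (simp add: edom_def)

lemma sp_Q_smooth_instance [simp]: "sp_Q (smooth_instance f) = UNIV"
  by (simp add: sp_Q_def)

lemma sp_F_smooth_instance [simp]: "sp_F (smooth_instance f) z = ereal (f z)"
  by (simp add: sp_F_def)

lemma proper_closed_convex_zero: "proper_closed_convex (\<lambda>_ :: 'a::euclidean_space. 0)"
proof -
  have eq: "epigraph (\<lambda>_ :: 'a. 0) = UNIV \<times> {0..}"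
    by (auto simp: epigraph_def zero_ereal_def)
  show ?thesis
    unfolding proper_closed_convex_def eq
    by (auto intro!: closed_Times convex_Times)
qed

text \<open>Class membership in terms of one explicit gradient \<open>g\<close>: tangent
  inequalities yield convexity and concavity, and with the start at 0 the distance condition bounds
  the norms of the saddle point.\<close>

lemma smooth_instance_in_SP0_class:
  fixes f :: "'a::euclidean_space \<times> 'b::euclidean_space \<Rightarrow> real"
  assumes P: "self_adjoint_pos_def Px" "self_adjoint_pos_def Py"
    and g: "\<And>z. GDERIV f z :> g z" "continuous_on UNIV g"
    and convex: "\<And>x x' y. f (x, y) + fst (g (x, y)) \<bullet> (x' - x) \<le> f (x', y)"
    and concave: "\<And>x y y'. f (x, y') \<le> f (x, y) + snd (g (x, y)) \<bullet> (y' - y)"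
    and saddle: "\<And>y. f (xs, y) \<le> f (xs, ys)" "\<And>x. f (xs, ys) \<le> f (x, ys)"
      "pnorm Px xs \<le> Dx" "pnorm Py ys \<le> Dy"
    and lipschitz: "\<And>x y x' y'. dual_pnorm Px (fst (g (x', y')) - fst (g (x, y)))
        \<le> Lx * pnorm Px (x' - x) + Lxy * pnorm Py (y' - y)"
      "\<And>x y x' y'. dual_pnorm Py (snd (g (x', y')) - snd (g (x, y)))
        \<le> Lxy * pnorm Px (x' - x) + Ly * pnorm Py (y' - y)"
  shows "smooth_instance f \<in> SP0_class Px Py Lx Lxy Ly Dx Dy"
proof -
  have "saddle_point (smooth_instance f) (xs, ys)
      \<and> (xs, ys) \<in> sp_ball Px Py Dx Dy (smooth_instance f)"
    using saddle by (auto simp: saddle_point_def sp_ball_def pnorm_minus P)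
  moreover have "convex_on UNIV (\<lambda>x. f (x, y))" for y
    by (rule convex_on_UNIV_above_tangent) (rule convex)
  moreover have "convex_on UNIV (\<lambda>y. - f (x, y))" for x
    by (rule convex_on_UNIV_above_tangent[of _ "\<lambda>y. - snd (g (x, y))"])
      (use concave in \<open>simp add: algebra_simps\<close>)
  ultimately show ?thesis
    unfolding SP0_class_def SP_class_def
    using g lipschitz
    by (auto simp: concave_on_def proper_closed_convex_zero grad_x_eq[OF g(1)] grad_y_eq[OF g(1)])
qed

lemma SP0_class_subset: "SP0_class Px Py Lx Lxy Ly Dx Dy \<subseteq> SP_class Px Py Lx Lxy Ly Dx Dy"
  by (auto simp: SP0_class_def)

lemma eps_saddle_smooth_instanceD:
  assumes "eps_saddle Px Py Dx Dy \<epsilon> (smooth_instance f) zb"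
    and "self_adjoint_pos_def Px" "self_adjoint_pos_def Py" "pnorm Px x \<le> Dx" "pnorm Py y \<le> Dy"
  shows "f (fst zb, y) - f (x, snd zb) \<le> \<epsilon>"
proof -
  have "(x, y) \<in> sp_ball Px Py Dx Dy (smooth_instance f) \<inter> sp_Q (smooth_instance f)"
    using assms(2-5) by (simp add: sp_ball_def pnorm_minus)
  then have "ereal (f (fst zb, y) - f (x, snd zb)) \<le> gap Px Py Dx Dy (smooth_instance f) zb"
    unfolding gap_def by (rule SUP_upper2) simp
  also have "\<dots> \<le> ereal \<epsilon>" using assms(1) by (simp add: eps_saddle_def)
  finally show ?thesis by simp
qed

section \<open>Dynamics of gradient-span methods\<close>

text \<open>If each query raises the level by at most one, the total number of queries bounds the
  level, however they are spread over rounds. The abstract form serves both agents.\<close>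

lemma chain_growth:
  fixes point :: "nat \<Rightarrow> nat \<Rightarrow> 'c" and grad :: "'c \<Rightarrow> 'a" and G :: "nat \<Rightarrow> 'a set"
  assumes mono: "\<And>k l. k \<le> l \<Longrightarrow> G k \<subseteq> G l"
    and step: "\<And>t l k. t < T \<Longrightarrow> l < \<tau> t \<Longrightarrow>
      grad ` ({point s m | s m. s < t \<and> m < \<tau> s} \<union> point t ` {..<l}) \<subseteq> G k \<Longrightarrow>
      grad (point t l) \<in> G (Suc k)"
  shows "grad ` {point s m | s m. s < T \<and> m < \<tau> s} \<subseteq> G (\<Sum>t<T. \<tau> t)"
proof -
  let ?Z = "\<lambda>t. {point s m | s m. s < t \<and> m < \<tau> s}"
  have "grad ` ?Z t \<subseteq> G (\<Sum>s<t. \<tau> s)" if "t \<le> T" for t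
    using that
  proof (induction t)
    case 0
    then show ?case by simp
  next
    case (Suc t)
    \<comment> \<open>Inner induction over the local queries of round \<open>t\<close>, on top of
      the level reached in earlier rounds.\<close>
    have "l \<le> \<tau> t \<Longrightarrow> grad ` (?Z t \<union> point t ` {..<l}) \<subseteq> G ((\<Sum>s<t. \<tau> s) + l)" for l
    proof (induction l)
      case 0
      then show ?case using Suc by simp
    next
      case (Suc l)
      then have "grad (point t l) \<in> G (Suc ((\<Sum>s<t. \<tau> s) + l))"
        using \<open>Suc t \<le> T\<close> by (intro step) auto
      moreover have "grad ` (?Z t \<union> point t ` {..<l}) \<subseteq> G (Suc ((\<Sum>s<t. \<tau> s) + l))"
        using Suc mono[of "(\<Sum>s<t. \<tau> s) + l" "Suc ((\<Sum>s<t. \<tau> s) + l)"] by auto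
      ultimately show ?case by (auto simp: lessThan_Suc)
    qed
    from this[of "\<tau> t"] have "grad ` (?Z t \<union> point t ` {..<\<tau> t}) \<subseteq> G (\<Sum>s<Suc t. \<tau> s)" by simp
    moreover have "?Z (Suc t) = ?Z t \<union> point t ` {..<\<tau> t}" by (auto simp: less_Suc_eq)
    ultimately show ?case by simp
  qed
  then show ?thesis by simp
qed

lemma round_active_mono: "round_active M I t \<Longrightarrow> s \<le> t \<Longrightarrow> round_active M I s"
  by (auto simp: round_active_def)

lemma gradient_spanD:
  assumes "gradient_span Px Py C M" and "I \<in> C" and "round_active M I t"
  shows "l < tau_x M I t \<Longrightarrow>
      fst (point_x M I t l) \<in> span_x Px I (Z_x M I t \<union> point_x M I t ` {..<l})"
    and "l < tau_x M I t \<Longrightarrow> snd (point_x M I t l) \<in> span_y Py I (Z_y M I t)"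
    and "l < tau_y M I t \<Longrightarrow>
      snd (point_y M I t l) \<in> span_y Py I (Z_y M I t \<union> point_y M I t ` {..<l})"
    and "l < tau_y M I t \<Longrightarrow> fst (point_y M I t l) \<in> span_x Px I (Z_x M I t)"
    and "fst (cand M I (Suc t)) \<in> span_x Px I (Z_x M I (Suc t))"
    and "snd (cand M I (Suc t)) \<in> span_y Py I (Z_y M I (Suc t))"
  using assms by (auto simp: gradient_span_def)

lemma Z_x_Suc: "Z_x M I (Suc t) = Z_x M I t \<union> point_x M I t ` {..<tau_x M I t}"
  by (auto simp: Z_x_def less_Suc_eq)

lemma Z_y_Suc: "Z_y M I (Suc t) = Z_y M I t \<union> point_y M I t ` {..<tau_y M I t}"
  by (auto simp: Z_y_def less_Suc_eq)

section \<open>Chain coordinates reached by the two agents\<close>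

locale two_chains =
  X: chain Px ux nx + Y: chain Py uy ny
  for Px :: "'a::euclidean_space \<Rightarrow> 'a" and ux nx
    and Py :: "'b::euclidean_space \<Rightarrow> 'b" and uy ny
begin

lemma span_x_leading:
  assumes "grad_x f ` Z \<subseteq> X.leading_dual k" and "x \<in> span_x Px (smooth_instance f) Z"
  shows "x \<in> X.leading k"
  using assms X.span_leading[OF assms(1)] by (auto simp: span_x_def)

lemma span_y_leading:
  assumes "grad_y f ` Z \<subseteq> Y.leading_dual k" and "y \<in> span_y Py (smooth_instance f) Z"
  shows "y \<in> Y.leading k"
  using assms Y.span_leading[OF assms(1)] by (auto simp: span_y_def)

text \<open>The condition on \<open>grad_x\<close> refers to the first component alone, so
  information from the other agent cannot speed up progress and only Agent x's own queries
  count.\<close>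

lemma candidate_x_leading:
  assumes M: "gradient_span Px Py C M" "smooth_instance f \<in> C"
      "round_active M (smooth_instance f) T"
    and grad: "\<And>z k. fst z \<in> X.leading k \<Longrightarrow> grad_x f z \<in> X.leading_dual (Suc k)"
  shows "fst (cand M (smooth_instance f) (Suc T))
    \<in> X.leading (\<Sum>t<Suc T. tau_x M (smooth_instance f) t)"
proof (rule span_x_leading[OF _ gradient_spanD(5)[OF M]])
  let ?I = "smooth_instance f"
  show "grad_x f ` Z_x M ?I (Suc T) \<subseteq> X.leading_dual (\<Sum>t<Suc T. tau_x M ?I t)"
    unfolding Z_x_def
  proof (rule chain_growth)
    fix t l k
    assume *: "t < Suc T" "l < tau_x M ?I t"
      "grad_x f ` ({point_x M ?I s m |s m. s < t \<and> m < tau_x M ?I s} \<union> point_x M ?I t ` {..<l})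
        \<subseteq> X.leading_dual k"
    have "round_active M ?I t" using *(1) by (intro round_active_mono[OF M(3)]) simp
    then show "grad_x f (point_x M ?I t l) \<in> X.leading_dual (Suc k)"
      using span_x_leading[OF *(3)] gradient_spanD(1)[OF M(1,2) _ *(2)]
      by (intro grad) (simp add: Z_x_def)
  qed (rule X.leading_dual_mono)
qed

lemma candidate_y_leading:
  assumes M: "gradient_span Px Py C M" "smooth_instance f \<in> C"
      "round_active M (smooth_instance f) T"
    and grad: "\<And>z k. snd z \<in> Y.leading k \<Longrightarrow> grad_y f z \<in> Y.leading_dual (Suc k)"
  shows "snd (cand M (smooth_instance f) (Suc T))
    \<in> Y.leading (\<Sum>t<Suc T. tau_y M (smooth_instance f) t)"
proof (rule span_y_leading[OF _ gradient_spanD(6)[OF M]])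
  let ?I = "smooth_instance f"
  show "grad_y f ` Z_y M ?I (Suc T) \<subseteq> Y.leading_dual (\<Sum>t<Suc T. tau_y M ?I t)"
    unfolding Z_y_def
  proof (rule chain_growth)
    fix t l k
    assume *: "t < Suc T" "l < tau_y M ?I t"
      "grad_y f ` ({point_y M ?I s m |s m. s < t \<and> m < tau_y M ?I s} \<union> point_y M ?I t ` {..<l})
        \<subseteq> Y.leading_dual k"
    have "round_active M ?I t" using *(1) by (intro round_active_mono[OF M(3)]) simp
    then show "grad_y f (point_y M ?I t l) \<in> Y.leading_dual (Suc k)"
      using span_y_leading[OF *(3)] gradient_spanD(3)[OF M(1,2) _ *(2)]
      by (intro grad) (simp add: Z_y_def)
  qed (rule Y.leading_dual_mono)
qed

text \<open>
  \<open>p\<close> and \<open>q\<close> bound the chain coordinates of \<open>y\<close> and \<open>x\<close> reached so far. A round moves \<open>(p, q)\<close>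
  at most to \<open>(q + 1, p)\<close>, and an agent's bound can only move if that agent makes a query;
  since \<open>p \<le> q + 1\<close> and \<open>q \<le> p\<close>, it moves by at most one.
\<close>

lemma alternating_growth:
  assumes M: "gradient_span Px Py C M" "smooth_instance f \<in> C"
    and act: "\<And>s. s < t \<Longrightarrow> round_active M (smooth_instance f) s"
    and grad_x: "\<And>z k. snd z \<in> Y.leading k \<Longrightarrow> grad_x f z \<in> X.leading_dual k"
    and grad_y: "\<And>z k. fst z \<in> X.leading k \<Longrightarrow> grad_y f z \<in> Y.leading_dual (Suc k)"
  shows "\<exists>p q. q \<le> p \<and> p \<le> Suc q \<and> 2 * q \<le> t \<and> 2 * p \<le> Suc t
    \<and> q \<le> (\<Sum>s<t. tau_x M (smooth_instance f) s) \<and> p \<le> (\<Sum>s<t. tau_y M (smooth_instance f) s)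
    \<and> grad_x f ` Z_x M (smooth_instance f) t \<subseteq> X.leading_dual q
    \<and> grad_y f ` Z_y M (smooth_instance f) t \<subseteq> Y.leading_dual p"
  using act
proof (induction t)
  case 0
  show ?case by (intro exI[of _ 0]) (simp add: Z_x_def Z_y_def)
next
  case (Suc t)
  let ?I = "smooth_instance f"
  obtain p q where pq: "q \<le> p" "p \<le> Suc q" "2 * q \<le> t" "2 * p \<le> Suc t"
    "q \<le> (\<Sum>s<t. tau_x M ?I s)" "p \<le> (\<Sum>s<t. tau_y M ?I s)"
    and Z: "grad_x f ` Z_x M ?I t \<subseteq> X.leading_dual q" "grad_y f ` Z_y M ?I t \<subseteq> Y.leading_dual p"
    using Suc by (metis less_SucI)
  have act: "round_active M ?I t" using Suc.prems by simp
  define q' where "q' = (if tau_x M ?I t = 0 then q else p)"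
  define p' where "p' = (if tau_y M ?I t = 0 then p else Suc q)"
  \<comment> \<open>Remote variables rest on gradients of earlier rounds only, so the old
    \<open>p\<close> and \<open>q\<close> stay valid for all local queries of the round.\<close>
  have "grad_x f (point_x M ?I t l) \<in> X.leading_dual p" if "l < tau_x M ?I t" for l
    using gradient_spanD(2)[OF M act that] span_y_leading[OF Z(2)] by (intro grad_x) auto
  then have "grad_x f ` Z_x M ?I (Suc t) \<subseteq> X.leading_dual q'"
    using Z(1) X.leading_dual_mono[OF pq(1)] by (auto simp: Z_x_Suc q'_def)
  moreover have "grad_y f (point_y M ?I t l) \<in> Y.leading_dual (Suc q)" if "l < tau_y M ?I t" for l
    using gradient_spanD(4)[OF M act that] span_x_leading[OF Z(1)] by (intro grad_y) auto
  then have "grad_y f ` Z_y M ?I (Suc t) \<subseteq> Y.leading_dual p'"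
    using Z(2) Y.leading_dual_mono[OF pq(2)] by (auto simp: Z_y_Suc p'_def)
  moreover have "q' \<le> p'" "p' \<le> Suc q'" "2 * q' \<le> Suc t" "2 * p' \<le> Suc (Suc t)"
    "q' \<le> (\<Sum>s<Suc t. tau_x M ?I s)" "p' \<le> (\<Sum>s<Suc t. tau_y M ?I s)"
    using pq by (auto simp: q'_def p'_def)
  ultimately show ?case by blast
qed

section \<open>The two hard instances\<close>

definition separable :: "real \<Rightarrow> real \<Rightarrow> real \<Rightarrow> real \<Rightarrow> 'a \<times> 'b \<Rightarrow> real" where
  "separable Lx cx Ly cy z = X.worst Lx cx (fst z) - Y.worst Ly cy (snd z)"

lemma GDERIV_separable:
  "GDERIV (separable Lx cx Ly cy) z :> (X.worst_grad Lx cx (fst z), - Y.worst_grad Ly cy (snd z))"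
proof -
  have "((\<lambda>z. X.worst Lx cx (fst z)) has_derivative (\<lambda>h. fst h \<bullet> X.worst_grad Lx cx (fst z))) (at z)"
    by (rule has_derivative_compose[of fst])
      (use X.GDERIV_worst in \<open>auto intro!: derivative_eq_intros simp: gderiv_def\<close>)
  moreover have
    "((\<lambda>z. Y.worst Ly cy (snd z)) has_derivative (\<lambda>h. snd h \<bullet> Y.worst_grad Ly cy (snd z))) (at z)"
    by (rule has_derivative_compose[of snd])
      (use Y.GDERIV_worst in \<open>auto intro!: derivative_eq_intros simp: gderiv_def\<close>)
  ultimately show ?thesis
    unfolding gderiv_def separable_def
    by (auto intro!: derivative_eq_intros simp: inner_prod_def)
qed

lemma separable_in_SP0_class:
  assumes "0 \<le> Lx" "0 \<le> Ly" "0 \<le> Lxy" "0 \<le> Dx" "0 \<le> Dy"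
    and "cx\<^sup>2 * real (Suc nx) / 3 \<le> Dx\<^sup>2" and "cy\<^sup>2 * real (Suc ny) / 3 \<le> Dy\<^sup>2"
  shows "smooth_instance (separable Lx cx Ly cy) \<in> SP0_class Px Py Lx Lxy Ly Dx Dy"
proof (rule smooth_instance_in_SP0_class[OF X.P Y.P GDERIV_separable,
      where xs = "X.worst_min cx" and ys = "Y.worst_min cy"])
  show "continuous_on UNIV (\<lambda>z. (X.worst_grad Lx cx (fst z), - Y.worst_grad Ly cy (snd z)))"
    by (intro continuous_intros)
  show "pnorm Px (X.worst_min cx) \<le> Dx"
    using X.pnorm_worst_min[of cx] assms by (auto intro: power2_le_imp_le[OF order_trans])
  show "pnorm Py (Y.worst_min cy) \<le> Dy"
    using Y.pnorm_worst_min[of cy] assms by (auto intro: power2_le_imp_le[OF order_trans])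
  fix x x' :: 'a and y y' :: 'b
  show "dual_pnorm Px (fst (X.worst_grad Lx cx (fst (x', y')), - Y.worst_grad Ly cy (snd (x', y')))
      - fst (X.worst_grad Lx cx (fst (x, y)), - Y.worst_grad Ly cy (snd (x, y))))
    \<le> Lx * pnorm Px (x' - x) + Lxy * pnorm Py (y' - y)"
    using X.worst_grad_lipschitz[of Lx cx x' x] assms pnorm_nonneg[OF Y.P, of "y' - y"]
    by (simp add: add_increasing2)
  \<comment> \<open>The minus sign of the second gradient component is absorbed by exchanging
    \<open>y\<close> and \<open>y'\<close>.\<close>
  have "pnorm Py (y - y') = pnorm Py (y' - y)"
    using pnorm_minus[OF Y.P, of "y' - y"] by simp
  then show "dual_pnorm Py (snd (X.worst_grad Lx cx (fst (x', y')), - Y.worst_grad Ly cy (snd (x', y')))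
      - snd (X.worst_grad Lx cx (fst (x, y)), - Y.worst_grad Ly cy (snd (x, y))))
    \<le> Lxy * pnorm Px (x' - x) + Ly * pnorm Py (y' - y)"
    using Y.worst_grad_lipschitz[of Ly cy y y'] assms pnorm_nonneg[OF X.P, of "x' - x"]
    by (simp add: add_increasing)
  show "separable Lx cx Ly cy (x, y)
      + fst (X.worst_grad Lx cx (fst (x, y)), - Y.worst_grad Ly cy (snd (x, y))) \<bullet> (x' - x)
    \<le> separable Lx cx Ly cy (x', y)"
    using X.worst_above_tangent[of Lx cx x x'] assms by (simp add: separable_def)
  show "separable Lx cx Ly cy (x, y')
    \<le> separable Lx cx Ly cy (x, y)
      + snd (X.worst_grad Lx cx (fst (x, y)), - Y.worst_grad Ly cy (snd (x, y))) \<bullet> (y' - y)"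
    using Y.worst_above_tangent[of Ly cy y y'] assms by (simp add: separable_def)
next
  fix y
  show "separable Lx cx Ly cy (X.worst_min cx, y)
      \<le> separable Lx cx Ly cy (X.worst_min cx, Y.worst_min cy)"
    using Y.worst_min_le assms by (simp add: separable_def)
next
  fix x
  show "separable Lx cx Ly cy (X.worst_min cx, Y.worst_min cy)
      \<le> separable Lx cx Ly cy (x, Y.worst_min cy)"
    using X.worst_min_le assms by (simp add: separable_def)
qed

text \<open>Tested at the two minimizers, the gap expression is the sum of the two suboptimalities;
  both are nonnegative, so each is at most \<open>\<epsilon>\<close>.\<close>

lemma separable_eps_saddleD:
  assumes "eps_saddle Px Py Dx Dy \<epsilon> (smooth_instance (separable Lx cx Ly cy)) zb"
    and "0 \<le> Lx" "0 \<le> Ly" "0 \<le> Dx" "0 \<le> Dy"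
    and "cx\<^sup>2 * real (Suc nx) / 3 \<le> Dx\<^sup>2" and "cy\<^sup>2 * real (Suc ny) / 3 \<le> Dy\<^sup>2"
  shows "X.worst Lx cx (fst zb) - X.worst Lx cx (X.worst_min cx) \<le> \<epsilon>"
    and "Y.worst Ly cy (snd zb) - Y.worst Ly cy (Y.worst_min cy) \<le> \<epsilon>"
proof -
  have "pnorm Px (X.worst_min cx) \<le> Dx"
    using X.pnorm_worst_min[of cx] assms by (auto intro: power2_le_imp_le[OF order_trans])
  moreover have "pnorm Py (Y.worst_min cy) \<le> Dy"
    using Y.pnorm_worst_min[of cy] assms by (auto intro: power2_le_imp_le[OF order_trans])
  ultimately have "separable Lx cx Ly cy (fst zb, Y.worst_min cy)
      - separable Lx cx Ly cy (X.worst_min cx, snd zb) \<le> \<epsilon>"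
    by (rule eps_saddle_smooth_instanceD[OF assms(1) X.P Y.P])
  moreover have "X.worst Lx cx (X.worst_min cx) \<le> X.worst Lx cx (fst zb)"
    "Y.worst Ly cy (Y.worst_min cy) \<le> Y.worst Ly cy (snd zb)"
    using X.worst_min_le Y.worst_min_le assms by auto
  ultimately show "X.worst Lx cx (fst zb) - X.worst Lx cx (X.worst_min cx) \<le> \<epsilon>"
    and "Y.worst Ly cy (snd zb) - Y.worst Ly cy (Y.worst_min cy) \<le> \<epsilon>"
    by (auto simp: separable_def)
qed

end

text \<open>With \<open>coord K\<close> still 0, only K + 1 residuals share the total
  \<open>- c\<close>, against 2 K + 2 at the minimizer. So the value is at least twice the minimum,
  and the difference is at least L c^2 / (16 (K + 1)).\<close>

lemma (in chain) worst_gap: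
  assumes n: "n = 2 * K + 1" and x: "coord K \<bullet> x = 0" and "0 \<le> L"
    and c: "c\<^sup>2 * real (Suc n) = 3 * D\<^sup>2"
  shows "3 * L * D\<^sup>2 \<le> 32 * (real K + 1)\<^sup>2 * (worst L c x - worst L c (worst_min c))"
proof -
  define k where "k = real K + 1"
  have k: "k > 0" "real (Suc K) = k" "real (Suc n) = 2 * k" by (auto simp: k_def n)
  have "3 * L * D\<^sup>2 = L * (c\<^sup>2 * (2 * k))" using c unfolding k(3) by simp
  also have "\<dots> = 32 * k\<^sup>2 * (L / 8 * (c\<^sup>2 / k) - L / 8 * (c\<^sup>2 / (2 * k)))"
    using k(1) by (simp add: field_simps power2_eq_square)
  also have "\<dots> \<le> 32 * k\<^sup>2 * (worst L c x - worst L c (worst_min c))"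
  proof (intro mult_left_mono diff_mono)
    show "L / 8 * (c\<^sup>2 / k) \<le> worst L c x"
      using worst_ge[OF x _ \<open>0 \<le> L\<close>, of c] n unfolding k(2) by simp
    show "worst L c (worst_min c) \<le> L / 8 * (c\<^sup>2 / (2 * k))"
      unfolding worst_worst_min k(3) by simp
  qed simp
  finally show ?thesis unfolding k_def .
qed

section \<open>The bilinear instance\<close>

locale paired_chains = two_chains Px ux n Py uy n
  for Px :: "'a::euclidean_space \<Rightarrow> 'a" and ux n and Py :: "'b::euclidean_space \<Rightarrow> 'b" and uy
begin

text \<open>The factor 1/2 compensates the norm 2 of the difference operator. The summand
  \<open>i = n\<close> is 0 and keeps the sums in the range used for
  \<open>diff_form\<close>.\<close>

definition bilinear :: "real \<Rightarrow> real \<Rightarrow> 'a \<times> 'b \<Rightarrow> real" where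
  "bilinear L c z = L / 2 * (\<Sum>i\<le>n. (Y.coord i \<bullet> snd z) * X.residual c i (fst z))"

definition bilinear_grad :: "real \<Rightarrow> real \<Rightarrow> 'a \<times> 'b \<Rightarrow> 'a \<times> 'b" where
  "bilinear_grad L c z =
    ((L / 2) *\<^sub>R (\<Sum>i\<le>n. (Y.coord i \<bullet> snd z) *\<^sub>R X.diff_form i),
     (L / 2) *\<^sub>R (\<Sum>i\<le>n. X.residual c i (fst z) *\<^sub>R Y.coord i))"

lemma GDERIV_bilinear: "GDERIV (bilinear L c) z :> bilinear_grad L c z"
proof -
  have "(bilinear L c has_derivative (\<lambda>h. L / 2 * (\<Sum>i\<le>n. (Y.coord i \<bullet> snd h) * X.residual c i (fst z)
      + (Y.coord i \<bullet> snd z) * (X.diff_form i \<bullet> fst h)))) (at z)"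
    unfolding bilinear_def
    by (auto intro!: derivative_eq_intros simp: algebra_simps)
  moreover have "(\<lambda>h. L / 2 * (\<Sum>i\<le>n. (Y.coord i \<bullet> snd h) * X.residual c i (fst z)
      + (Y.coord i \<bullet> snd z) * (X.diff_form i \<bullet> fst h))) = (\<lambda>h. h \<bullet> bilinear_grad L c z)"
    by (simp add: bilinear_grad_def inner_prod_def inner_sum_right sum.distrib distrib_left
        inner_commute[of _ "X.diff_form _"] inner_commute[of _ "Y.coord _"] mult.commute add.commute)
  ultimately show ?thesis by (simp add: gderiv_def)
qed

text \<open>Component \<open>j\<close> is a multiple of the difference of the coordinates
  \<open>j\<close> and \<open>j + 1\<close> of \<open>y\<close>: nothing beyond the known part of
  \<open>y\<close> appears.\<close>

lemma bilinear_grad_x_leading: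
  assumes "snd z \<in> Y.leading k"
  shows "grad_x (bilinear L c) z \<in> X.leading_dual k"
  unfolding grad_x_eq[OF GDERIV_bilinear] using assms
  by (auto simp: bilinear_grad_def X.leading_dual_def Y.leading_def X.u_diff_form_sum)

text \<open>Component \<open>j\<close> is a multiple of residual \<open>j\<close>, which for
  \<open>j > 0\<close> also involves coordinate \<open>j - 1\<close> of \<open>x\<close>; hence one
  level more. At \<open>j = 0\<close> the constant \<open>c\<close> starts the chain.\<close>

lemma bilinear_grad_y_leading:
  assumes "fst z \<in> X.leading k"
  shows "grad_y (bilinear L c) z \<in> Y.leading_dual (Suc k)"
proof -
  have "uy j \<bullet> (\<Sum>i\<le>n. r i *\<^sub>R Y.coord i) = r j" if "j < n" for j and r :: "nat \<Rightarrow> real"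
    using that by (simp add: inner_sum_right Y.u_coord if_distrib[of "(*) _"] cong: if_cong)
  then show ?thesis
    unfolding grad_y_eq[OF GDERIV_bilinear]
    using X.residual_leading[OF assms] by (auto simp: bilinear_grad_def Y.leading_dual_def)
qed

text \<open>Constant coordinates \<open>c\<close> annihilate every residual below \<open>n\<close>;
  the residual at \<open>n\<close> is multiplied by \<open>Y.coord n\<close>, which is 0.\<close>

lemma bilinear_saddle_x: "bilinear L c (X.comb (\<lambda>_. c), y) = 0"
proof -
  have *: "(Y.coord i \<bullet> y) * X.residual c i (X.comb (\<lambda>_. c)) = 0" for i
  proof (cases "i < n")
    case True
    then show ?thesis by (cases i) (simp_all add: X.residual_def inner_diff_left X.coord_comb)
  qed (simp add: Y.coord_def)
  show ?thesis
    by (simp only: bilinear_def fst_conv snd_conv * sum.neutral_const mult_zero_right)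
qed

lemma bilinear_zero: "bilinear L c (x, 0) = 0"
  by (simp add: bilinear_def)

text \<open>The function is affine in each variable, so the tangent inequalities are equalities, and
  its value at the saddle point is 0. The Bessel constants 1 and 2 against \<open>L / 2\<close> give
  the coupling constant \<open>L\<close>.\<close>

lemma bilinear_in_SP0_class:
  assumes L: "0 \<le> L" "0 \<le> Lx" "0 \<le> Ly" and D: "0 \<le> Dx" "0 \<le> Dy"
    and c: "real n * c\<^sup>2 \<le> Dx\<^sup>2"
  shows "smooth_instance (bilinear L c) \<in> SP0_class Px Py Lx L Ly Dx Dy"
proof (rule smooth_instance_in_SP0_class[OF X.P Y.P GDERIV_bilinear,
      where xs = "X.comb (\<lambda>_. c)" and ys = 0])
  show "continuous_on UNIV (bilinear_grad L c)"
    unfolding bilinear_grad_def by (intro continuous_intros)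
  show "pnorm Px (X.comb (\<lambda>_. c)) \<le> Dx"
    by (rule power2_le_imp_le) (use c D in \<open>simp_all add: X.pnorm_comb\<close>)
  show "pnorm Py 0 \<le> Dy" using D by (simp add: pnorm_zero[OF Y.P])
  fix x x' :: 'a and y y' :: 'b
  show "bilinear L c (x, y) + fst (bilinear_grad L c (x, y)) \<bullet> (x' - x) \<le> bilinear L c (x', y)"
  proof -
    have "X.residual c i x' = X.residual c i x + X.diff_form i \<bullet> (x' - x)" for i
      using X.residual_diff[of c i x' x] by simp
    then show ?thesis
      by (simp add: bilinear_def bilinear_grad_def inner_sum_left distrib_left sum.distrib)
  qed
  show "bilinear L c (x, y') \<le> bilinear L c (x, y) + snd (bilinear_grad L c (x, y)) \<bullet> (y' - y)"
  proof -
    have "Y.coord i \<bullet> y' = Y.coord i \<bullet> y + Y.coord i \<bullet> (y' - y)" for i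
      by (simp add: inner_diff_right)
    then show ?thesis
      by (simp add: bilinear_def bilinear_grad_def inner_sum_left distrib_left distrib_right
          sum.distrib mult.commute)
  qed
  have nn: "0 \<le> pnorm Px z" "0 \<le> pnorm Py w" for z w
    using pnorm_nonneg[OF X.P] pnorm_nonneg[OF Y.P] by auto
  have "dual_pnorm Px (fst (bilinear_grad L c (x', y')) - fst (bilinear_grad L c (x, y)))
      \<le> L * pnorm Py (y' - y)"
  proof (rule dual_pnorm_le[OF X.P])
    fix h
    have "(fst (bilinear_grad L c (x', y')) - fst (bilinear_grad L c (x, y))) \<bullet> h
        = L / 2 * (\<Sum>i\<le>n. (Y.coord i \<bullet> (y' - y)) * (X.diff_form i \<bullet> h))"
      by (simp add: bilinear_grad_def inner_diff_left inner_diff_right inner_sum_left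
          sum_subtractf left_diff_distrib right_diff_distrib)
    also have "\<dots> \<le> L / 2 * (pnorm Py (y' - y) * (2 * pnorm Px h))"
      using L nn
      by (intro mult_left_mono sum_mult_le_of_sum_squares_le Y.coord_bessel X.diff_form_bessel) auto
    finally show "(fst (bilinear_grad L c (x', y')) - fst (bilinear_grad L c (x, y))) \<bullet> h
        \<le> L * pnorm Py (y' - y) * pnorm Px h" by simp
  qed (use L nn in simp)
  then show "dual_pnorm Px (fst (bilinear_grad L c (x', y')) - fst (bilinear_grad L c (x, y)))
      \<le> Lx * pnorm Px (x' - x) + L * pnorm Py (y' - y)"
    using L nn by (simp add: add_increasing)
  have "dual_pnorm Py (snd (bilinear_grad L c (x', y')) - snd (bilinear_grad L c (x, y)))
      \<le> L * pnorm Px (x' - x)"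
  proof (rule dual_pnorm_le[OF Y.P])
    fix h
    have "(snd (bilinear_grad L c (x', y')) - snd (bilinear_grad L c (x, y))) \<bullet> h
        = L / 2 * (\<Sum>i\<le>n. (X.diff_form i \<bullet> (x' - x)) * (Y.coord i \<bullet> h))"
      by (simp add: bilinear_grad_def X.residual_diff[of c, symmetric] inner_diff_left
          inner_sum_left sum_subtractf left_diff_distrib right_diff_distrib)
    also have "\<dots> \<le> L / 2 * ((2 * pnorm Px (x' - x)) * pnorm Py h)"
      using L nn
      by (intro mult_left_mono sum_mult_le_of_sum_squares_le Y.coord_bessel X.diff_form_bessel) auto
    finally show "(snd (bilinear_grad L c (x', y')) - snd (bilinear_grad L c (x, y))) \<bullet> h
        \<le> L * pnorm Px (x' - x) * pnorm Py h" by simp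
  qed (use L nn in simp)
  then show "dual_pnorm Py (snd (bilinear_grad L c (x', y')) - snd (bilinear_grad L c (x, y)))
      \<le> L * pnorm Px (x' - x) + Ly * pnorm Py (y' - y)"
    using L nn by (simp add: add_increasing2)
qed (simp_all add: bilinear_saddle_x bilinear_zero)

text \<open>The test point \<open>y\<close> has constant coordinates \<open>- d\<close>, so that the residuals telescope.\<close>

lemma bilinear_eps_saddleD:
  assumes "eps_saddle Px Py Dx Dy \<epsilon> (smooth_instance (bilinear L c)) zb"
    and n: "n = Suc m" and zb: "X.coord m \<bullet> fst zb = 0" and D: "0 \<le> Dx" "0 \<le> Dy"
    and c: "real n * c\<^sup>2 \<le> Dx\<^sup>2" and d: "real n * d\<^sup>2 \<le> Dy\<^sup>2"
  shows "L * c * d / 2 \<le> \<epsilon>"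
proof -
  let ?y = "Y.comb (\<lambda>_. - d)"
  have "pnorm Px (X.comb (\<lambda>_. c)) \<le> Dx"
    by (rule power2_le_imp_le) (use c D in \<open>simp_all add: X.pnorm_comb\<close>)
  moreover have "pnorm Py ?y \<le> Dy"
    by (rule power2_le_imp_le) (use d D in \<open>simp_all add: Y.pnorm_comb\<close>)
  ultimately have
    "bilinear L c (fst zb, ?y) - bilinear L c (X.comb (\<lambda>_. c), snd zb) \<le> \<epsilon>"
    by (rule eps_saddle_smooth_instanceD[OF assms(1) X.P Y.P])
  moreover have "bilinear L c (fst zb, ?y) = L / 2 * (\<Sum>i\<le>m. - d * X.residual c i (fst zb))"
  proof -
    \<comment> \<open>The summand \<open>i = n\<close> drops out, since \<open>Y.coord n\<close> is
      0.\<close>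
    have "bilinear L c (fst zb, ?y) = L / 2 * (\<Sum>i<n. - d * X.residual c i (fst zb))"
      by (simp add: bilinear_def lessThan_Suc_atMost[symmetric] Y.coord_comb cong: sum.cong_simp)
    moreover have "{..<n} = {..m}" using n by (simp add: lessThan_Suc_atMost)
    ultimately show ?thesis by simp
  qed
  moreover have "(\<Sum>i\<le>m. - d * X.residual c i (fst zb)) = c * d"
    unfolding sum_distrib_left[symmetric] X.sum_residual zb by simp
  ultimately show ?thesis by (simp add: bilinear_saddle_x)
qed

end

section \<open>Lower bounds for the complexities\<close>

lemma exists_bilinear_instance:
  fixes Px :: "'a::euclidean_space \<Rightarrow> 'a" and Py :: "'b::euclidean_space \<Rightarrow> 'b"
  assumes P: "self_adjoint_pos_def Px" "self_adjoint_pos_def Py"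
    and L: "0 \<le> Lx" "0 \<le> Lxy" "0 \<le> Ly" and D: "0 \<le> Dx" "0 \<le> Dy"
    and M: "gradient_span Px Py (SP0_class Px Py Lx Lxy Ly Dx Dy) M"
    and N: "N \<le> DIM('a)" "N \<le> DIM('b)" "2 * real N * \<epsilon> < Lxy * Dx * Dy"
  shows "\<exists>I\<in>SP0_class Px Py Lx Lxy Ly Dx Dy. \<forall>T. solved_at Px Py Dx Dy \<epsilon> M I T \<longrightarrow>
    2 * N \<le> T \<and> N \<le> (\<Sum>t<T. tau_x M I t) \<and> N \<le> (\<Sum>t<T. tau_y M I t)"
proof -
  obtain ux where "\<forall>i<N. \<forall>j<N. Px (ux i) \<bullet> ux j = (if i = j then 1 else 0)"
    using exists_orthonormal_family[OF P(1) N(1)] by blast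
  moreover obtain uy where "\<forall>i<N. \<forall>j<N. Py (uy i) \<bullet> uy j = (if i = j then 1 else 0)"
    using exists_orthonormal_family[OF P(2) N(2)] by blast
  ultimately interpret paired_chains Px ux N Py uy
    using P by unfold_locales auto
  \<comment> \<open>For \<open>N > 0\<close> the vectors with constant coordinates \<open>c\<close>
    and \<open>d\<close> have norms exactly \<open>Dx\<close> and \<open>Dy\<close>. For
    \<open>N = 0\<close> division by zero gives 0, hence inequalities in \<open>cd\<close>.\<close>
  define c d where "c = Dx / sqrt (real N)" and "d = Dy / sqrt (real N)"
  have cd: "real N * c\<^sup>2 \<le> Dx\<^sup>2" "real N * d\<^sup>2 \<le> Dy\<^sup>2"
    by (auto simp: c_def d_def power_divide)
  let ?I = "smooth_instance (bilinear Lxy c)"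
  have I: "?I \<in> SP0_class Px Py Lx Lxy Ly Dx Dy"
    using L D cd by (intro bilinear_in_SP0_class) auto
  have "2 * N \<le> T \<and> N \<le> (\<Sum>t<T. tau_x M ?I t) \<and> N \<le> (\<Sum>t<T. tau_y M ?I t)"
    if solved: "solved_at Px Py Dx Dy \<epsilon> M ?I T" for T
  proof -
    obtain T' where "T = Suc T'" using solved by (cases T) (auto simp: solved_at_def)
    with solved have T: "T = Suc T'" "round_active M ?I T'"
      "eps_saddle Px Py Dx Dy \<epsilon> ?I (cand M ?I T)"
      by (auto simp: solved_at_def)
    have "round_active M ?I s" if "s < T" for s
      using that T by (auto intro: round_active_mono)
    from alternating_growth[OF M I this bilinear_grad_x_leading bilinear_grad_y_leading]
    obtain p q where pq: "q \<le> p" "2 * q \<le> T" "q \<le> (\<Sum>t<T. tau_x M ?I t)"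
        "p \<le> (\<Sum>t<T. tau_y M ?I t)"
      and Z: "grad_x (bilinear Lxy c) ` Z_x M ?I T \<subseteq> X.leading_dual q"
      by blast
    \<comment> \<open>Otherwise the last chain coordinate of the candidate is 0, which forces Lxy Dx
      Dy / (2 N) \<le> \<epsilon>.\<close>
    have "N \<le> q"
    proof (rule ccontr)
      assume "\<not> N \<le> q"
      then obtain m where m: "N = Suc m" "q \<le> m" by (cases N) auto
      have "fst (cand M ?I T) \<in> X.leading q"
        using span_x_leading[OF Z] gradient_spanD(5)[OF M I T(2)] T(1) by simp
      then have "X.coord m \<bullet> fst (cand M ?I T) = 0" using m(2) by (simp add: X.leading_def)
      from bilinear_eps_saddleD[OF T(3) m(1) this D cd]
      have "Lxy * c * d / 2 \<le> \<epsilon>" .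
      moreover have "c * d = Dx * Dy / real N" by (simp add: c_def d_def)
      ultimately show False using N(3) m(1) by (simp add: field_simps)
    qed
    then show ?thesis using pq by linarith
  qed
  then show ?thesis using I by blast
qed

text \<open>One instance serves both agents, with independent chain lengths. The two conclusions are
  separate implications because either premise may fail, even for \<open>K = 0\<close>.\<close>

lemma exists_separable_instance:
  fixes Px :: "'a::euclidean_space \<Rightarrow> 'a" and Py :: "'b::euclidean_space \<Rightarrow> 'b"
  assumes P: "self_adjoint_pos_def Px" "self_adjoint_pos_def Py"
    and L: "0 \<le> Lx" "0 \<le> Lxy" "0 \<le> Ly" and D: "0 \<le> Dx" "0 \<le> Dy"
    and M: "gradient_span Px Py (SP0_class Px Py Lx Lxy Ly Dx Dy) M"
    and K: "2 * Kx + 1 \<le> DIM('a)" "2 * Ky + 1 \<le> DIM('b)"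
  shows "\<exists>I\<in>SP0_class Px Py Lx Lxy Ly Dx Dy. \<forall>T. solved_at Px Py Dx Dy \<epsilon> M I T \<longrightarrow>
    (32 * (real Kx + 1)\<^sup>2 * \<epsilon> < 3 * Lx * Dx\<^sup>2 \<longrightarrow> Kx < (\<Sum>t<T. tau_x M I t)) \<and>
    (32 * (real Ky + 1)\<^sup>2 * \<epsilon> < 3 * Ly * Dy\<^sup>2 \<longrightarrow> Ky < (\<Sum>t<T. tau_y M I t))"
proof -
  define nx ny where n: "nx = 2 * Kx + 1" "ny = 2 * Ky + 1"
  obtain ux where "\<forall>i<nx. \<forall>j<nx. Px (ux i) \<bullet> ux j = (if i = j then 1 else 0)"
    using exists_orthonormal_family[OF P(1)] K(1) unfolding n by blast
  moreover obtain uy where "\<forall>i<ny. \<forall>j<ny. Py (uy i) \<bullet> uy j = (if i = j then 1 else 0)"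
    using exists_orthonormal_family[OF P(2)] K(2) unfolding n by blast
  ultimately interpret two_chains Px ux nx Py uy ny
    using P by unfold_locales auto
  \<comment> \<open>The scale makes the bound of \<open>pnorm_worst_min\<close> equal to the squared
    radius.\<close>
  define cx where "cx = Dx * sqrt (3 / real (Suc nx))"
  define cy where "cy = Dy * sqrt (3 / real (Suc ny))"
  have c: "cx\<^sup>2 * real (Suc nx) = 3 * Dx\<^sup>2" "cy\<^sup>2 * real (Suc ny) = 3 * Dy\<^sup>2"
    by (simp_all add: cx_def cy_def power_mult_distrib del: of_nat_Suc)
  then have c': "cx\<^sup>2 * real (Suc nx) / 3 \<le> Dx\<^sup>2" "cy\<^sup>2 * real (Suc ny) / 3 \<le> Dy\<^sup>2"
    by simp_all
  let ?f = "separable Lx cx Ly cy"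
  let ?I = "smooth_instance ?f"
  have I: "?I \<in> SP0_class Px Py Lx Lxy Ly Dx Dy"
    using L D c' by (intro separable_in_SP0_class)
  have "(32 * (real Kx + 1)\<^sup>2 * \<epsilon> < 3 * Lx * Dx\<^sup>2 \<longrightarrow> Kx < (\<Sum>t<T. tau_x M ?I t)) \<and>
    (32 * (real Ky + 1)\<^sup>2 * \<epsilon> < 3 * Ly * Dy\<^sup>2 \<longrightarrow> Ky < (\<Sum>t<T. tau_y M ?I t))"
    if solved: "solved_at Px Py Dx Dy \<epsilon> M ?I T" for T
  proof -
    obtain T' where "T = Suc T'" using solved by (cases T) (auto simp: solved_at_def)
    with solved have T: "T = Suc T'" "round_active M ?I T'"
      "eps_saddle Px Py Dx Dy \<epsilon> ?I (cand M ?I T)"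
      by (auto simp: solved_at_def)
    note gap = separable_eps_saddleD[OF T(3) L(1,3) D c']
    have "grad_x ?f z \<in> X.leading_dual (Suc k)" if "fst z \<in> X.leading k" for z k
      unfolding grad_x_eq[OF GDERIV_separable] fst_conv using that by (rule X.worst_grad_leading)
    from candidate_x_leading[OF M I T(2) this]
    have "fst (cand M ?I T) \<in> X.leading (\<Sum>t<T. tau_x M ?I t)" unfolding T(1) .
    then have x: "X.coord Kx \<bullet> fst (cand M ?I T) = 0" if "\<not> Kx < (\<Sum>t<T. tau_x M ?I t)"
      using that by (simp add: X.leading_def)
    have "grad_y ?f z \<in> Y.leading_dual (Suc k)" if "snd z \<in> Y.leading k" for z k
      unfolding grad_y_eq[OF GDERIV_separable] snd_conv
      using that by (intro subspace_neg Y.subspace_leading_dual Y.worst_grad_leading)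
    from candidate_y_leading[OF M I T(2) this]
    have "snd (cand M ?I T) \<in> Y.leading (\<Sum>t<T. tau_y M ?I t)" unfolding T(1) .
    then have y: "Y.coord Ky \<bullet> snd (cand M ?I T) = 0" if "\<not> Ky < (\<Sum>t<T. tau_y M ?I t)"
      using that by (simp add: Y.leading_def)
    have "3 * Lx * Dx\<^sup>2 \<le> 32 * (real Kx + 1)\<^sup>2 * \<epsilon>" if "\<not> Kx < (\<Sum>t<T. tau_x M ?I t)"
      using X.worst_gap[OF n(1) x[OF that] L(1) c(1)] gap(1)
      by (elim order_trans) (intro mult_left_mono; simp)
    moreover have "3 * Ly * Dy\<^sup>2 \<le> 32 * (real Ky + 1)\<^sup>2 * \<epsilon>" if "\<not> Ky < (\<Sum>t<T. tau_y M ?I t)"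
      using Y.worst_gap[OF n(2) y[OF that] L(3) c(2)] gap(2)
      by (elim order_trans) (intro mult_left_mono; simp)
    ultimately show ?thesis by (meson not_le)
  qed
  then show ?thesis using I by blast
qed

section \<open>From single instances to the complexities\<close>

lemma T_instE:
  assumes "T_inst Px Py Dx Dy \<epsilon> M I \<noteq> \<infinity>"
  obtains T where "T_inst Px Py Dx Dy \<epsilon> M I = enat T" "solved_at Px Py Dx Dy \<epsilon> M I T"
proof -
  have *: "\<exists>k. solved_at Px Py Dx Dy \<epsilon> M I k" using assms by (auto simp: T_inst_def split: if_splits)
  show thesis
  proof (rule that)
    show "T_inst Px Py Dx Dy \<epsilon> M I = enat (LEAST k. solved_at Px Py Dx Dy \<epsilon> M I k)"
      using * by (simp add: T_inst_def)
    show "solved_at Px Py Dx Dy \<epsilon> M I (LEAST k. solved_at Px Py Dx Dy \<epsilon> M I k)"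
      using * by (rule LeastI_ex)
  qed
qed

text \<open>Only solved rounds need an estimate: an instance that is never solved contributes
  infinity.\<close>

lemma comm_complexity_ge:
  assumes "I \<in> C" and "\<And>T. solved_at Px Py Dx Dy \<epsilon> M I T \<Longrightarrow> B \<le> real T"
  shows "ereal B \<le> comm_complexity Px Py Dx Dy \<epsilon> C M"
proof -
  have "ereal B \<le> ereal_of_enat (T_inst Px Py Dx Dy \<epsilon> M I)"
  proof (cases "T_inst Px Py Dx Dy \<epsilon> M I = \<infinity>")
    case False
    then show ?thesis by (rule T_instE) (simp add: assms(2))
  qed simp
  then show ?thesis
    unfolding comm_complexity_def using assms(1) by (rule SUP_upper2[rotated])
qed

lemma oracle_complexity_ge:
  assumes "I \<in> C"
    and "\<And>T. solved_at Px Py Dx Dy \<epsilon> M I T \<Longrightarrow>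
      B \<le> cx * real (\<Sum>t<T. tau_x M I t) + cy * real (\<Sum>t<T. tau_y M I t)"
  shows "ereal B \<le> oracle_complexity Px Py Dx Dy \<epsilon> cx cy C M"
proof (cases "\<exists>I\<in>C. T_inst Px Py Dx Dy \<epsilon> M I = \<infinity>")
  case True
  then show ?thesis by (simp add: oracle_complexity_def)
next
  case False
  then have "T_inst Px Py Dx Dy \<epsilon> M I \<noteq> \<infinity>" using assms(1) by metis
  then have *: "ereal B \<le> ereal cx * N_x_inst Px Py Dx Dy \<epsilon> M I + ereal cy * N_y_inst Px Py Dx Dy \<epsilon> M I"
    by (rule T_instE) (use assms(2) in \<open>simp add: N_x_inst_def N_y_inst_def\<close>)
  show ?thesis
    unfolding oracle_complexity_def if_not_P[OF False] using assms(1) * by (rule SUP_upper2)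
qed

text \<open>The largest integer strictly below \<open>a\<close>; strictness is what pushes the gap
  of the hard instances above \<open>\<epsilon>\<close>.\<close>

lemma exists_nat_between_minus_one:
  fixes a :: real
  assumes "0 < a"
  obtains N :: nat where "real N < a" "a - 1 \<le> real N"
proof
  show "real (nat (\<lceil>a\<rceil> - 1)) < a" "a - 1 \<le> real (nat (\<lceil>a\<rceil> - 1))"
    using assms by linarith+
qed

text \<open>\<open>K\<close> must have \<open>2 K + 1\<close> coordinates available, hence the case \<open>s \<le> 1\<close> with \<open>K = 0\<close>.\<close>

lemma exists_query_bound:
  fixes s :: real
  assumes "2 * s \<le> real n" and "1 \<le> n"
  obtains K :: nat where "2 * K + 1 \<le> n" "s \<le> 1 \<or> real K + 1 < s" "s - 2 \<le> real K"
proof (cases "s \<le> 1")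
  case True
  then show ?thesis using assms that[of 0] by simp
next
  case False
  then obtain K :: nat where K: "real K < s - 1" "s - 1 - 1 \<le> real K"
    using exists_nat_between_minus_one[of "s - 1"] by auto
  then have "real (2 * K + 1) \<le> real n" using assms(1) by simp
  then have "2 * K + 1 \<le> n" by (simp only: of_nat_le_iff)
  then show ?thesis using K that[of K] by simp
qed

lemma power2_less_of_less_sqrt:
  assumes "real K + 1 < sqrt (3 * L * D\<^sup>2 / (32 * \<epsilon>))" and "0 < \<epsilon>"
  shows "32 * (real K + 1)\<^sup>2 * \<epsilon> < 3 * L * D\<^sup>2"
proof -
  have "(real K + 1)\<^sup>2 < 3 * L * D\<^sup>2 / (32 * \<epsilon>)"
    using assms(1) by (smt (verit) of_nat_0_le_iff real_le_lsqrt)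
  then show ?thesis using assms(2) by (simp add: field_simps)
qed

theorem theorem6p15:
  fixes Px :: "real ^ 'nx \<Rightarrow> real ^ 'nx" and Py :: "real ^ 'ny \<Rightarrow> real ^ 'ny"
    and Lx Lxy Ly Dx Dy \<epsilon> cx cy :: real
    and M :: "(real ^ 'nx, real ^ 'ny) dist_alg"
  assumes "self_adjoint_pos_def Px" and "self_adjoint_pos_def Py"
    and "Lx > 0" and "Lxy > 0" and "Ly > 0" and "Dx > 0" and "Dy > 0" and "\<epsilon> > 0"
    and "cx \<ge> 0" and "cy \<ge> 0"
    and "distributed_for (SP_class Px Py Lx Lxy Ly Dx Dy) M"
    and "gradient_span Px Py (SP0_class Px Py Lx Lxy Ly Dx Dy) M"
    and "real CARD('nx) \<ge> 2 * Lxy * Dx * Dy / (3 * \<epsilon>) + sqrt (3 * Lx * Dx\<^sup>2 / (8 * \<epsilon>)) + 2"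
    and "real CARD('ny) \<ge> 2 * Lxy * Dx * Dy / (3 * \<epsilon>) + sqrt (3 * Ly * Dy\<^sup>2 / (8 * \<epsilon>)) + 2"
  shows "comm_complexity Px Py Dx Dy \<epsilon> (SP_class Px Py Lx Lxy Ly Dx Dy) M
           \<ge> ereal (2 * Lxy * Dx * Dy / (3 * \<epsilon>) - 2) \<and>
         oracle_complexity Px Py Dx Dy \<epsilon> cx cy (SP_class Px Py Lx Lxy Ly Dx Dy) M
           \<ge> ereal ((cx + cy) / 9 * (Lxy * Dx * Dy / \<epsilon>)
                     + cx / 3 * sqrt (3 * Lx * Dx\<^sup>2 / (32 * \<epsilon>))
                     + cy / 3 * sqrt (3 * Ly * Dy\<^sup>2 / (32 * \<epsilon>))
                     - (2 * cx + 2 * cy) / 3)"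
proof -
  let ?C = "SP_class Px Py Lx Lxy Ly Dx Dy" and ?S = "SP0_class Px Py Lx Lxy Ly Dx Dy"
  have nonneg: "0 \<le> Lx" "0 \<le> Lxy" "0 \<le> Ly" "0 \<le> Dx" "0 \<le> Dy" using assms by simp_all
  define a where "a = Lxy * Dx * Dy / \<epsilon>"
  define sx where "sx = sqrt (3 * Lx * Dx\<^sup>2 / (32 * \<epsilon>))"
  define sy where "sy = sqrt (3 * Ly * Dy\<^sup>2 / (32 * \<epsilon>))"
  have a: "a > 0" "2 * Lxy * Dx * Dy / (3 * \<epsilon>) = 2 / 3 * a" using assms by (simp_all add: a_def)
  have s0: "0 \<le> sx" "0 \<le> sy" using assms by (simp_all add: sx_def sy_def)
  \<comment> \<open>The square root in the dimension bound is \<open>2 * sx\<close> or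
    \<open>2 * sy\<close>, which pays for the 2 K + 1 coordinates of the separable instance.\<close>
  have quad: "sqrt (3 * L * D / (8 * \<epsilon>)) = 2 * sqrt (3 * L * D / (32 * \<epsilon>))" for L D
  proof -
    have "3 * L * D / (8 * \<epsilon>) = 4 * (3 * L * D / (32 * \<epsilon>))"
      using \<open>\<epsilon> > 0\<close> by (simp add: field_simps)
    then show ?thesis by (simp only: real_sqrt_mult real_sqrt_four)
  qed
  have nx: "2 / 3 * a + 2 * sx + 2 \<le> real CARD('nx)"
    and ny: "2 / 3 * a + 2 * sy + 2 \<le> real CARD('ny)"
    using assms(13,14) by (simp_all add: a(2) sx_def sy_def quad)

  \<comment> \<open>\<open>a / 2\<close> is the threshold at which Lxy Dx Dy / (2 N) equals
    \<open>\<epsilon>\<close>. It lies below \<open>2 / 3 * a\<close>, so the dimensions suffice,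
    and 2 N \<ge> a - 2 gives the round bound.\<close>
  obtain N :: nat where N: "real N < a / 2" "a / 2 - 1 \<le> real N"
    using exists_nat_between_minus_one[of "a / 2"] a(1) by auto
  have "N \<le> CARD('nx)" "N \<le> CARD('ny)" using N(1) nx ny s0 a(1) by linarith+
  moreover have "2 * real N * \<epsilon> < Lxy * Dx * Dy"
    using N(1) \<open>\<epsilon> > 0\<close> by (simp add: a_def field_simps)
  ultimately obtain I where "I \<in> ?S" and
    I: "\<And>T. solved_at Px Py Dx Dy \<epsilon> M I T \<Longrightarrow>
      2 * N \<le> T \<and> N \<le> (\<Sum>t<T. tau_x M I t) \<and> N \<le> (\<Sum>t<T. tau_y M I t)"
    using exists_bilinear_instance[OF assms(1,2) nonneg assms(12), of N \<epsilon>] by auto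
  then have "I \<in> ?C" using SP0_class_subset by blast
  have comm: "ereal (2 * Lxy * Dx * Dy / (3 * \<epsilon>) - 2) \<le> comm_complexity Px Py Dx Dy \<epsilon> ?C M"
  proof (rule comm_complexity_ge[OF \<open>I \<in> ?C\<close>])
    fix T assume "solved_at Px Py Dx Dy \<epsilon> M I T"
    then have "real (2 * N) \<le> real T" using I by (simp only: of_nat_le_iff)
    then show "2 * Lxy * Dx * Dy / (3 * \<epsilon>) - 2 \<le> real T"
      unfolding a(2) using N(2) a(1) by simp
  qed
  have oracle1: "ereal ((cx + cy) * real N) \<le> oracle_complexity Px Py Dx Dy \<epsilon> cx cy ?C M"
  proof (rule oracle_complexity_ge[OF \<open>I \<in> ?C\<close>])
    fix T assume "solved_at Px Py Dx Dy \<epsilon> M I T"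
    then have "cx * real N + cy * real N
        \<le> cx * real (\<Sum>t<T. tau_x M I t) + cy * real (\<Sum>t<T. tau_y M I t)"
      using I assms(9,10) by (intro add_mono mult_left_mono) (simp_all only: of_nat_le_iff)
    then show "(cx + cy) * real N \<le> \<dots>" by (simp add: distrib_right)
  qed

  obtain Kx where Kx: "2 * Kx + 1 \<le> CARD('nx)" "sx \<le> 1 \<or> real Kx + 1 < sx" "sx - 2 \<le> real Kx"
    using exists_query_bound[of sx "CARD('nx)"] nx a(1) by auto
  obtain Ky where Ky: "2 * Ky + 1 \<le> CARD('ny)" "sy \<le> 1 \<or> real Ky + 1 < sy" "sy - 2 \<le> real Ky"
    using exists_query_bound[of sy "CARD('ny)"] ny a(1) by auto
  obtain J where "J \<in> ?S" and J: "\<And>T. solved_at Px Py Dx Dy \<epsilon> M J T \<Longrightarrow>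
    (32 * (real Kx + 1)\<^sup>2 * \<epsilon> < 3 * Lx * Dx\<^sup>2 \<longrightarrow> Kx < (\<Sum>t<T. tau_x M J t)) \<and>
    (32 * (real Ky + 1)\<^sup>2 * \<epsilon> < 3 * Ly * Dy\<^sup>2 \<longrightarrow> Ky < (\<Sum>t<T. tau_y M J t))"
    using exists_separable_instance[OF assms(1,2) nonneg assms(12), of Kx Ky \<epsilon>] Kx(1) Ky(1)
    by auto
  then have "J \<in> ?C" using SP0_class_subset by blast
  have oracle2: "ereal (cx * (sx - 1) + cy * (sy - 1)) \<le> oracle_complexity Px Py Dx Dy \<epsilon> cx cy ?C M"
  proof (rule oracle_complexity_ge[OF \<open>J \<in> ?C\<close>])
    fix T assume T: "solved_at Px Py Dx Dy \<epsilon> M J T"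
    have "sx - 1 \<le> real (\<Sum>t<T. tau_x M J t)"
    \<comment> \<open>For \<open>sx \<le> 1\<close> the bound is at most 0. Otherwise at least
      \<open>Kx + 1\<close> queries occur, which improves \<open>sx - 2\<close> to
      \<open>sx - 1\<close>.\<close>
    proof (cases "sx \<le> 1")
      case False
      then have "Kx < (\<Sum>t<T. tau_x M J t)"
        using J[OF T] Kx(2) power2_less_of_less_sqrt[of Kx Lx Dx \<epsilon>] \<open>\<epsilon> > 0\<close> by (simp add: sx_def)
      then show ?thesis using Kx(3) by linarith
    qed linarith
    moreover have "sy - 1 \<le> real (\<Sum>t<T. tau_y M J t)"
    proof (cases "sy \<le> 1")
      case False
      then have "Ky < (\<Sum>t<T. tau_y M J t)"
        using J[OF T] Ky(2) power2_less_of_less_sqrt[of Ky Ly Dy \<epsilon>] \<open>\<epsilon> > 0\<close> by (simp add: sy_def)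
      then show ?thesis using Ky(3) by linarith
    qed linarith
    ultimately show "cx * (sx - 1) + cy * (sy - 1)
        \<le> cx * real (\<Sum>t<T. tau_x M J t) + cy * real (\<Sum>t<T. tau_y M J t)"
      using assms(9,10) by (intro add_mono mult_left_mono)
  qed

  let ?B = "(cx + cy) / 9 * (Lxy * Dx * Dy / \<epsilon>) + cx / 3 * sx + cy / 3 * sy - (2 * cx + 2 * cy) / 3"
  let ?B1 = "(cx + cy) * real N" and ?B2 = "cx * (sx - 1) + cy * (sy - 1)"
  have nonneg_B1: "0 \<le> ?B1" using assms(9,10) by simp
  have "(cx + cy) * (a / 3 - 1) \<le> ?B1"
    using N(2) a(1) assms(9,10) by (intro mult_left_mono) simp_all
  moreover have "3 * ?B = (cx + cy) * (a / 3 - 1) + ?B2"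
    unfolding a_def[symmetric] by (simp add: field_simps)
  ultimately have "3 * ?B \<le> ?B1 + ?B2" by simp
  \<comment> \<open>The bounds come from different instances and cannot be added. If
    \<open>B\<close> exceeded both, then 2 B > B1 + B2 \<ge> 3 B would make \<open>B\<close>
    negative, against \<open>B > B1\<close> and \<open>B1 \<ge> 0\<close>.\<close>
  moreover have "B \<le> B1 \<or> B \<le> B2" if "3 * B \<le> B1 + B2" "0 \<le> B1" for B B1 B2 :: real
    using that by linarith
  ultimately have "?B \<le> ?B1 \<or> ?B \<le> ?B2" using nonneg_B1 by blast
  then have "ereal ?B \<le> oracle_complexity Px Py Dx Dy \<epsilon> cx cy ?C M"
    using oracle1 oracle2 by (meson ereal_less_eq(3) order_trans)
  then show ?thesis using comm by (simp add: sx_def sy_def)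
qed

end
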